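(* Let $\Gamma = \mathcal{N}(2m;1,b,b+m+1;m-1)$, where $b = 4b_0-1$ for some integer $b_0 > 1$ and $m > 2$ is an even divisor of $b^2+3$ with $m \equiv 2 \pmod{4}$ and $b < 2m$. Then $\Gamma$ is a half-arc-transitive graph. Moreover, its reachability relation is universal if and only if $3$ does not divide $m$, while in the case that $3$ divides $m$ the graph $\Gamma$ has exactly three alternets.
   Context: For integers $n \geq 4$ and $1 \leq a,b,c,k \leq n-1$ with $k \neq n/2$ and $a,b,c$ pairwise distinct, the Nest graph $\mathcal{N}(n;a,b,c;k)$ is the graph with vertex set $\{u_i : i \in \mathbb{Z}_n\} \cup \{v_i : i \in \mathbb{Z}_n\}$ and edges $u_iu_{i+1}$, $v_iv_{i+k}$, $u_iv_i$, $u_iv_{i+a}$, $u_iv_{i+b}$, $u_iv_{i+c}$ for $i \in \mathbb{Z}_n$ (indices modulo $n$); parameters written as expressions are taken modulo $n$ as residues in $\{1,\dots,n-1\}$. A graph is half-arc-transitive if its automorphism group acts transitively on vertices and edges but not on arcs. In a half-arc-transitive graph the automorphism group induces two mutually opposite orientations of the edges; fix one. An alternating path is a path whose consecutive edges are traversed alternately along and against the orientation. An edge $f$ is reachable from an edge $e$ if there is an alternating path whose first edge is $e$ and last edge is $f$; this reachability relation is an equivalence relation on edges (independent of the chosen orientation), its classes are called alternets, and it is universal if there is only one alternet. *)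

theory Defs
  imports "HOL-Combinatorics.Permutations"
begin

section \<open>Graphs and their symmetry\<close>

record 'a ugraph =
  uverts :: "'a set"
  uedges :: "'a set set"

definition simple_graph :: "'a ugraph \<Rightarrow> bool" where
  "simple_graph G \<longleftrightarrow> (\<forall>e\<in>uedges G. e \<subseteq> uverts G \<and> card e = 2)"

definition arcs :: "'a ugraph \<Rightarrow> ('a \<times> 'a) set" where
  "arcs G = {(x, y). {x, y} \<in> uedges G}"

text \<open>Automorphisms are extended by the identity outside the vertex set (as \<open>permutes\<close> demands).\<close>

definition automorphisms :: "'a ugraph \<Rightarrow> ('a \<Rightarrow> 'a) set" where
  "automorphisms G = {f. f permutes uverts G \<and>
     (\<forall>x\<in>uverts G. \<forall>y\<in>uverts G. {f x, f y} \<in> uedges G \<longleftrightarrow> {x, y} \<in> uedges G)}"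

definition vertex_transitive :: "'a ugraph \<Rightarrow> bool" where
  "vertex_transitive G \<longleftrightarrow>
     (\<forall>x\<in>uverts G. \<forall>y\<in>uverts G. \<exists>f\<in>automorphisms G. f x = y)"

definition edge_transitive :: "'a ugraph \<Rightarrow> bool" where
  "edge_transitive G \<longleftrightarrow>
     (\<forall>e\<in>uedges G. \<forall>e'\<in>uedges G. \<exists>f\<in>automorphisms G. f ` e = e')"

definition arc_transitive :: "'a ugraph \<Rightarrow> bool" where
  "arc_transitive G \<longleftrightarrow>
     (\<forall>(x, y)\<in>arcs G. \<forall>(x', y')\<in>arcs G. \<exists>f\<in>automorphisms G. f x = x' \<and> f y = y')"

definition half_arc_transitive :: "'a ugraph \<Rightarrow> bool" where
  "half_arc_transitive G \<longleftrightarrow>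
     vertex_transitive G \<and> edge_transitive G \<and> \<not> arc_transitive G"


section \<open>Alternating paths, reachability and alternets\<close>

text \<open>In a half-arc-transitive graph the automorphism group has exactly two orbits on the arcs.
  Each contains exactly one of the two arcs underlying any edge, and they are converse to each
  other: these are the two induced orientations.\<close>

definition induced_orientation :: "'a ugraph \<Rightarrow> ('a \<times> 'a) set \<Rightarrow> bool" where
  "induced_orientation G D \<longleftrightarrow>
     (\<exists>(x, y)\<in>arcs G. D = {(f x, f y) | f. f \<in> automorphisms G})"

text \<open>A path is given by its list of vertices, and vertices and edges may be repeated (with
  distinct vertices required, transitivity of reachability would not be clear). The flag \<open>p\<close> tells
  whether the first edge is traversed along or against the orientation.\<close>

definition alternating_path :: "('a \<times> 'a) set \<Rightarrow> 'a list \<Rightarrow> bool" where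
  "alternating_path D xs \<longleftrightarrow> 2 \<le> length xs \<and>
     (\<exists>p. \<forall>i. Suc i < length xs \<longrightarrow>
        (if even i = p then (xs ! i, xs ! Suc i) \<in> D else (xs ! Suc i, xs ! i) \<in> D))"

definition reachability :: "'a ugraph \<Rightarrow> ('a \<times> 'a) set \<Rightarrow> ('a set \<times> 'a set) set" where
  "reachability G D = {(e, f). e \<in> uedges G \<and> f \<in> uedges G \<and>
     (\<exists>xs. alternating_path D xs \<and> e = {xs ! 0, xs ! 1} \<and>
           f = {xs ! (length xs - 2), xs ! (length xs - 1)})}"

definition alternets :: "'a ugraph \<Rightarrow> ('a \<times> 'a) set \<Rightarrow> 'a set set set" where
  "alternets G D = uedges G // reachability G D"

definition universal_reachability :: "'a ugraph \<Rightarrow> ('a \<times> 'a) set \<Rightarrow> bool" where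
  "universal_reachability G D \<longleftrightarrow> card (alternets G D) = 1"


section \<open>Nest graphs\<close>

datatype nest_vertex = U nat | V nat

definition nest_parameters :: "nat \<Rightarrow> nat \<Rightarrow> nat \<Rightarrow> nat \<Rightarrow> nat \<Rightarrow> bool" where
  "nest_parameters n a b c k \<longleftrightarrow> 4 \<le> n \<and> {a, b, c, k} \<subseteq> {1..n - 1} \<and> 2 * k \<noteq> n \<and>
     a \<noteq> b \<and> a \<noteq> c \<and> b \<noteq> c"

text \<open>Residues modulo \<open>n\<close> are represented by \<open>{..<n}\<close>. The definition is meant for arguments
  satisfying \<open>nest_parameters\<close>.\<close>

definition nest_graph :: "nat \<Rightarrow> nat \<Rightarrow> nat \<Rightarrow> nat \<Rightarrow> nat \<Rightarrow> nest_vertex ugraph" where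
  "nest_graph n a b c k =
     \<lparr>uverts = U ` {..<n} \<union> V ` {..<n},
      uedges = (\<Union>i\<in>{..<n}.
        {{U i, U ((i + 1) mod n)}, {V i, V ((i + k) mod n)},
         {U i, V i}, {U i, V ((i + a) mod n)}, {U i, V ((i + b) mod n)}, {U i, V ((i + c) mod n)}})\<rparr>"

lemma add_mod_neq_self:
  fixes i k n :: nat
  assumes "i < n" "1 \<le> k" "k \<le> n - 1"
  shows "(i + k) mod n \<noteq> i"
  using assms by (cases "i + k < n") (auto simp: mod_if)

lemma nest_graph_simple:
  assumes "nest_parameters n a b c k"
  shows "simple_graph (nest_graph n a b c k)"
proof -
  have "i \<noteq> (i + 1) mod n" "i \<noteq> (i + k) mod n" if "i < n" for i
    using add_mod_neq_self[OF that, of 1] add_mod_neq_self[OF that, of k] assms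
    by (auto simp: nest_parameters_def)
  then show ?thesis
    using assms
    by (auto simp: simple_graph_def nest_graph_def nest_parameters_def card_insert_if)
qed

text \<open>The parameters of the family studied here are admissible.\<close>

lemma nest_parameters_family:
  fixes m b b0 :: nat
  assumes "b0 > 1" "b = 4 * b0 - 1" "m > 2" "m dvd b\<^sup>2 + 3" "m mod 4 = 2" "b < 2 * m"
  shows "nest_parameters (2 * m) 1 b ((b + m + 1) mod (2 * m)) (m - 1)"
proof -
  let ?c = "(b + m + 1) mod (2 * m)"
  have "odd b" "b \<ge> 7" using assms by auto
  have "even m" using assms(5) by presburger
  then have "even (b + m + 1)" using \<open>odd b\<close> by simp
  then have "even ?c" by (simp add: dvd_mod)
  have "?c \<noteq> 0"
  proof
    assume "?c = 0"
    then have "2 * m dvd b + m + 1" by (rule mod_0_imp_dvd)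
    then have "m dvd b + 1"
      by (metis add.commute add.left_commute dvd_add_triv_left_iff dvd_mult_right)
    then have "m dvd (b + 1) * (b - 1)" by (rule dvd_mult2)
    moreover have "(b + 1) * (b - 1) + 4 = b\<^sup>2 + 3"
      using \<open>b \<ge> 7\<close> by (cases b) (auto simp: power2_eq_square)
    ultimately have "m dvd 4"
      using assms(4) by (metis dvd_add_right_iff)
    then have "m \<le> 4" by (simp add: dvd_imp_le)
    then have "m = 3 \<or> m = 4" using assms(3) by auto
    then show False using assms(5) by auto
  qed
  moreover have "?c \<le> 2 * m - 1"
    using mod_less_divisor[of "2 * m" "b + m + 1"] assms(3) by linarith
  moreover have "?c \<noteq> 1" "?c \<noteq> b" using \<open>even ?c\<close> \<open>odd b\<close> by auto
  ultimately show ?thesis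
    unfolding nest_parameters_def using assms(3,6) \<open>b \<ge> 7\<close> by auto
qed

end

theory Submission
  imports Defs
begin

text \<open>Put \<open>c = b + m + 1\<close>, read indices modulo \<open>2 m\<close> and orient the edges as
  \<open>u i \<rightarrow> u (i + 1), v i, v (i + b)\<close> and \<open>v i \<rightarrow> u (i - 1), u (i - c), v (i + m + 1)\<close>. Splitting the
  vertices by type and parity of the index gives four classes; besides the translations there are an
  automorphism exchanging the \<open>u\<close> and the \<open>v\<close> and one of order three preserving the class of \<open>u 0\<close>
  and permuting the other three cyclically, and together these are transitive on the oriented edges.
  Since every edge lies in exactly one triangle and \<open>v i, v (i + 1)\<close> is the only pair of
  neighbours of \<open>u i\<close> containing one of these two that lies on two pentagons through \<open>u i\<close>, an
  automorphism fixing \<open>u 0\<close> and moving \<open>u 1\<close> to \<open>u (- 1)\<close> would satisfy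
  \<open>u i \<mapsto> u (- i)\<close> and \<open>v i \<mapsto> v (1 - i)\<close>, which is impossible because \<open>v (1 - b)\<close> is not adjacent
  to \<open>u 0\<close>. So the given orientation or its opposite is the induced one. Giving the oriented edges with
  tail \<open>u i\<close> the colour \<open>i\<close> and those with tail \<open>v i\<close> the colour \<open>i + 1\<close>, modulo \<open>gcd 3 m\<close>, the
  alternets are exactly the colour classes.\<close>

section \<open>Composition and inversion of automorphisms\<close>

lemma automorphisms_comp:
  assumes "f \<in> automorphisms G" "g \<in> automorphisms G"
  shows "g \<circ> f \<in> automorphisms G"
proof -
  have "f x \<in> uverts G" if "x \<in> uverts G" for x
    using assms(1) that by (simp add: automorphisms_def permutes_in_image)
  then show ?thesis
    using assms by (auto simp: automorphisms_def intro: permutes_compose)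
qed

lemma automorphism_inv:
  assumes "f \<in> automorphisms G"
  shows "inv f \<in> automorphisms G"
proof -
  have p: "f permutes uverts G" using assms by (simp add: automorphisms_def)
  have im: "inv f x \<in> uverts G" if "x \<in> uverts G" for x
    using permutes_inv[OF p] that by (simp add: permutes_in_image)
  have "{inv f x, inv f y} \<in> uedges G \<longleftrightarrow> {x, y} \<in> uedges G"
    if "x \<in> uverts G" "y \<in> uverts G" for x y
  proof -
    have "{f (inv f x), f (inv f y)} \<in> uedges G \<longleftrightarrow> {inv f x, inv f y} \<in> uedges G"
      using assms im[OF that(1)] im[OF that(2)] by (auto simp: automorphisms_def)
    then show ?thesis by (simp add: permutes_inverses(1)[OF p])
  qed
  then show ?thesis using permutes_inv[OF p] by (simp add: automorphisms_def)
qed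

section \<open>Symbolic names of vertices\<close>

text \<open>The quadruple \<open>(t, x, y, z)\<close> stands for the vertex with index \<open>j + x + y b + z m\<close>, of type
  \<open>v\<close> iff \<open>t\<close>. The number \<open>x\<^sup>2 + 3 y\<^sup>2\<close> in \<open>apart\<close> is congruent modulo \<open>m\<close> to the norm
  \<open>(x + y b) (x - y b)\<close>, because \<open>b\<^sup>2 = - 3\<close> modulo \<open>m\<close>; it is never \<open>4\<close>, \<open>12\<close> or \<open>16\<close> for two names
  of one vertex, as no admissible \<open>m\<close> divides these.\<close>

type_synonym symbolic_vertex = "bool \<times> int \<times> int \<times> int"

fun nbrs :: "symbolic_vertex \<Rightarrow> symbolic_vertex list" where
  "nbrs (False, x, y, z) = [(False, x + 1, y, z), (False, x - 1, y, z), (True, x, y, z),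
     (True, x + 1, y, z), (True, x, y + 1, z), (True, x + 1, y + 1, z + 1)]"
| "nbrs (True, x, y, z) = [(True, x + 1, y, z + 1), (True, x - 1, y, z - 1), (False, x, y, z),
     (False, x - 1, y, z), (False, x, y - 1, z), (False, x - 1, y - 1, z - 1)]"

fun apart :: "symbolic_vertex \<Rightarrow> symbolic_vertex \<Rightarrow> bool" where
  "apart (t, x, y, z) (t', x', y', z') \<longleftrightarrow> t \<noteq> t'
     \<or> ((x - x') - (y - y') + 2 * (z - z')) mod 4 \<noteq> 0
     \<or> (x - x') * (x - x') + 3 * ((y - y') * (y - y')) \<in> {4, 12, 16}"

text \<open>A certificate of equality, as \<open>apart\<close> is one of inequality; pairs of names
  may satisfy neither. Only the parity of the multiple of \<open>m\<close> matters, because indices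
  are read modulo \<open>2 * m\<close>.\<close>

fun same :: "symbolic_vertex \<Rightarrow> symbolic_vertex \<Rightarrow> bool" where
  "same (t, x, y, z) (t', x', y', z') \<longleftrightarrow> t = t' \<and> x = x' \<and> y = y' \<and> (z - z') mod 2 = 0"

text \<open>An upper bound: since \<open>apart\<close> only certifies inequality, the list keeps
  every name that might denote a common neighbour.\<close>

definition common_nbrs :: "symbolic_vertex \<Rightarrow> symbolic_vertex \<Rightarrow> symbolic_vertex list" where
  "common_nbrs s t = filter (\<lambda>p. \<exists>r\<in>set (nbrs t). \<not> apart r p) (nbrs s)"

text \<open>Candidates \<open>(p, q)\<close> for the 5-cycle \<open>w\<close>, \<open>s\<close>,
  \<open>p\<close>, \<open>q\<close>, \<open>t\<close>. Again an upper bound: a pair is discarded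
  only when a coincidence is certified by \<open>same\<close> or a missing edge by
  \<open>apart\<close>.\<close>

definition pentagons :: "symbolic_vertex \<Rightarrow> symbolic_vertex \<Rightarrow> symbolic_vertex \<Rightarrow> (symbolic_vertex \<times> symbolic_vertex) list" where
  "pentagons w s t = filter (\<lambda>(p, q). \<not> same p w \<and> \<not> same q w \<and> \<not> same p t \<and> \<not> same q s
     \<and> (\<exists>r\<in>set (nbrs p). \<not> apart r q)) (List.product (nbrs s) (nbrs t))"

section \<open>Counting classes and prolonging alternating paths\<close>

lemma card_quotient_kernel:
  assumes "R = {(x, y). x \<in> A \<and> y \<in> A \<and> h x = h y}"
  shows "card (A // R) = card (h ` A)"
proof -
  have "R `` {x} = {y \<in> A. h y = h x}" if "x \<in> A" for x
    using that by (auto simp: assms)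
  then have "A // R = (\<lambda>r. {x \<in> A. h x = r}) ` (h ` A)"
    unfolding quotient_def UNION_singleton_eq_range image_image by (rule image_cong[OF refl])
  moreover have "inj_on (\<lambda>r. {x \<in> A. h x = r}) (h ` A)"
    by (auto simp: inj_on_def set_eq_iff)
  ultimately show ?thesis by (simp add: card_image)
qed

text \<open>The flag of the first edge is an explicit argument, so that alternation can be unfolded
  vertex by vertex, the flag flipping each time.\<close>

definition alternates :: "('a \<times> 'a) set \<Rightarrow> bool \<Rightarrow> 'a list \<Rightarrow> bool" where
  "alternates D p xs \<longleftrightarrow> (\<forall>i. Suc i < length xs \<longrightarrow>
     (if even i = p then (xs ! i, xs ! Suc i) \<in> D else (xs ! Suc i, xs ! i) \<in> D))"

lemma alternating_path_altdef:
  "alternating_path D xs \<longleftrightarrow> 2 \<le> length xs \<and> (\<exists>p. alternates D p xs)"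
  by (simp add: alternating_path_def alternates_def)

lemma alternates_Cons:
  "alternates D p (w # x # xs) \<longleftrightarrow>
    (if p then (w, x) \<in> D else (x, w) \<in> D) \<and> alternates D (\<not> p) (x # xs)"
  (is "?L \<longleftrightarrow> ?R")
proof
  assume L: ?L
  have "alternates D (\<not> p) (x # xs)" unfolding alternates_def
  proof (intro allI impI)
    fix i assume "Suc i < length (x # xs)"
    then show "if even i = (\<not> p) then ((x # xs) ! i, (x # xs) ! Suc i) \<in> D
      else ((x # xs) ! Suc i, (x # xs) ! i) \<in> D"
      using L[unfolded alternates_def, rule_format, of "Suc i"] by (auto split: if_splits)
  qed
  moreover have "if p then (w, x) \<in> D else (x, w) \<in> D"
    using L[unfolded alternates_def, rule_format, of 0] by auto
  ultimately show ?R by blast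
next
  assume R: ?R
  show ?L unfolding alternates_def
  proof (intro allI impI)
    fix i assume i: "Suc i < length (w # x # xs)"
    show "if even i = p then ((w # x # xs) ! i, (w # x # xs) ! Suc i) \<in> D
      else ((w # x # xs) ! Suc i, (w # x # xs) ! i) \<in> D"
    proof (cases i)
      case 0 then show ?thesis using R by auto
    next
      case (Suc k)
      then show ?thesis
        using R[THEN conjunct2, unfolded alternates_def, rule_format, of k] i
        by (auto split: if_splits)
    qed
  qed
qed

lemma alternates_converse: "alternates (D\<inverse>) p xs \<longleftrightarrow> alternates D (\<not> p) xs"
  by (auto simp: alternates_def)

text \<open>Reversing all arcs only flips the flag, so it suffices to study one of the two induced
  orientations.\<close>

lemma reachability_converse: "reachability G (D\<inverse>) = reachability G D"
proof -
  have "(\<exists>p. alternates (D\<inverse>) p xs) \<longleftrightarrow> (\<exists>p. alternates D p xs)" for xs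
    unfolding alternates_converse ex_bool_eq by auto
  then show ?thesis by (simp add: reachability_def alternating_path_altdef)
qed

text \<open>Prolongs an alternating path at its start. The positions \<open>length zs\<close> and
  \<open>Suc (length zs)\<close> hold the last two vertices of \<open>x # y # zs\<close>.\<close>

lemma reachability_Cons:
  assumes "alternates D p (x # y # zs)"
    "(if p then (x, v) \<in> D else (v, x) \<in> D)" "{v, x} \<in> uedges G"
    "f = {(x # y # zs) ! length zs, (x # y # zs) ! Suc (length zs)}" "f \<in> uedges G"
  shows "({v, x}, f) \<in> reachability G D"
proof -
  have "alternates D (\<not> p) (v # x # y # zs)" using assms(1,2) by (auto simp: alternates_Cons)
  then have "alternating_path D (v # x # y # zs)" by (auto simp: alternating_path_altdef)
  then show ?thesis using assms by (auto simp: reachability_def intro!: exI[of _ "v # x # y # zs"])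
qed

section \<open>The family with integer indices: vertices, oriented edges, neighbourhoods\<close>

locale nest_family =
  fixes m b c :: int
  assumes c_def: "c = b + m + 1" and m_gt: "m > 2" and m_mod: "m mod 4 = 2" and b_mod: "b mod 4 = 3"
    and b_gt: "b > 3" and b_less: "b < 2 * m" and m_dvd: "m dvd b\<^sup>2 + 3"
begin

text \<open>Integer indices make negative shifts available and turn equality of vertices into
  congruence modulo \<open>2 * m\<close>.\<close>

definition u :: "int \<Rightarrow> nest_vertex" where "u i = U (nat (i mod (2 * m)))"
definition v :: "int \<Rightarrow> nest_vertex" where "v i = V (nat (i mod (2 * m)))"

definition G :: "nest_vertex ugraph" where
  "G = nest_graph (2 * nat m) 1 (nat b) ((nat b + nat m + 1) mod (2 * nat m)) (nat m - 1)"

abbreviation E :: "nest_vertex set set" where "E \<equiv> uedges G"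

lemma u_eq_iff: "u i = u j \<longleftrightarrow> 2 * m dvd i - j"
  using m_gt by (auto simp: u_def mod_eq_dvd_iff[symmetric] eq_nat_nat_iff)

lemma v_eq_iff: "v i = v j \<longleftrightarrow> 2 * m dvd i - j"
  using m_gt by (auto simp: v_def mod_eq_dvd_iff[symmetric] eq_nat_nat_iff)

lemma u_neq_v [simp]: "u i \<noteq> v j" "v j \<noteq> u i"
  by (auto simp: u_def v_def)

lemma u_of_nat: "u (int i) = U (i mod (2 * nat m))"
  and v_of_nat: "v (int i) = V (i mod (2 * nat m))"
proof -
  have "nat (int i mod (2 * m)) = i mod (2 * nat m)"
    using m_gt by (subst nat_mod_distrib) (auto simp: nat_mult_distrib)
  then show "u (int i) = U (i mod (2 * nat m))" "v (int i) = V (i mod (2 * nat m))"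
    by (auto simp: u_def v_def)
qed

lemma u_shift: "u i = u (i + 2 * m * k)" and v_shift: "v i = v (i + 2 * m * k)"
  by (auto simp: u_eq_iff v_eq_iff)

lemma verts_G: "uverts G = range u \<union> range v"
proof -
  have *: "(\<lambda>i. nat (i mod (2 * m))) ` UNIV = {..<2 * nat m}"
  proof (intro equalityI subsetI)
    fix x assume "x \<in> {..<2 * nat m}"
    then have "x = nat (int x mod (2 * m))"
      using m_gt by (simp add: nat_mult_distrib)
    then show "x \<in> (\<lambda>i. nat (i mod (2 * m))) ` UNIV" by blast
  next
    fix x assume "x \<in> (\<lambda>i. nat (i mod (2 * m))) ` UNIV"
    then show "x \<in> {..<2 * nat m}"
      using m_gt by (auto simp: nat_less_iff)
  qed
  have "range u = U ` {..<2 * nat m}" "range v = V ` {..<2 * nat m}"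
    unfolding *[symmetric] by (auto simp: u_def v_def image_image)
  then show ?thesis by (simp add: G_def nest_graph_def)
qed

definition darts :: "(nest_vertex \<times> nest_vertex) set" where
  "darts = (\<Union>i. {(u i, u (i + 1)), (u i, v i), (u i, v (i + b)),
     (v i, u (i - 1)), (v i, u (i - c)), (v i, v (i + m + 1))})"

lemma dartsI:
  "(u i, u (i + 1)) \<in> darts" "(u i, v i) \<in> darts" "(u i, v (i + b)) \<in> darts"
  "(v i, u (i - 1)) \<in> darts" "(v i, u (i - c)) \<in> darts" "(v i, v (i + m + 1)) \<in> darts"
  by (auto simp: darts_def)

lemma edges_G: "E = (\<lambda>(x, y). {x, y}) ` darts"
proof -
  let ?n = "2 * nat m"
  \<comment> \<open>The six edges attached to the index \<open>i\<close> in
    \<open>nest_graph\<close>, now for any integer \<open>i\<close>. As \<open>e\<close> has period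
    \<open>2 * m\<close>, its union over the residues is its union over all integers.\<close>
  define e where "e i = {{u i, u (i + 1)}, {v i, v (i + m - 1)}, {u i, v i}, {u i, v (i + 1)},
    {u i, v (i + b)}, {u i, v (i + c)}}" for i
  have e_shift: "e i = e (i + 2 * m * k)" for i k
  proof -
    have "u (i + 2 * m * k + d) = u (i + d)" "v (i + 2 * m * k + d) = v (i + d)" for d
      using u_shift[of "i + d" k] v_shift[of "i + d" k] by (auto simp: algebra_simps)
    from this[of 0] this[of 1] this[of "m - 1"] this[of b] this[of c]
    show ?thesis by (simp add: e_def algebra_simps)
  qed
  have "e (int i) = {{U i, U ((i + 1) mod ?n)}, {V i, V ((i + (nat m - 1)) mod ?n)},
        {U i, V i}, {U i, V ((i + 1) mod ?n)}, {U i, V ((i + nat b) mod ?n)},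
        {U i, V ((i + (nat b + nat m + 1) mod ?n) mod ?n)}}" if "i < ?n" for i
  proof -
    have "int i + m - 1 = int (i + (nat m - 1))" "int i + 1 = int (i + 1)"
      "int i + b = int (i + nat b)" "int i + c = int (i + (nat b + nat m + 1))"
      using m_gt b_gt by (auto simp: c_def nat_diff_distrib)
    then show ?thesis
      using that unfolding e_def by (simp only: u_of_nat v_of_nat mod_add_right_eq mod_less)
  qed
  then have "E = (\<Union>i<?n. e (int i))"
    by (auto simp: G_def nest_graph_def)
  also have "\<dots> = (\<Union>i. e i)"
  proof -
    have "e i = e (int (nat (i mod (2 * m))))" and "nat (i mod (2 * m)) < ?n" for i
    proof -
      have "i = i mod (2 * m) + 2 * m * (i div (2 * m))" by simp
      then show "e i = e (int (nat (i mod (2 * m))))"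
        using e_shift[of "i mod (2 * m)" "i div (2 * m)"] m_gt by simp
      show "nat (i mod (2 * m)) < ?n"
        using m_gt by (auto simp: nat_less_iff)
    qed
    then show ?thesis by blast
  qed
  also have "\<dots> = (\<lambda>(x, y). {x, y}) ` darts"
  proof (intro equalityI subsetI)
    fix s assume "s \<in> (\<Union>i. e i)"
    then obtain i where i: "s \<in> e i" by auto
    \<comment> \<open>The shifts \<open>m - 1\<close> and \<open>m + 1\<close> are opposite modulo
      \<open>2 * m\<close>, so this edge carries the dart that leaves
      \<open>v (i + m - 1)\<close>.\<close>
    have "v i = v (i + m - 1 + m + 1)" using v_shift[of i 1] by (simp add: algebra_simps)
    then have "(v (i + m - 1), v i) \<in> darts" using dartsI(6)[of "i + m - 1"] by simp
    then have "{v i, v (i + m - 1)} \<in> (\<lambda>(x, y). {x, y}) ` darts"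
      by (auto simp: insert_commute intro!: rev_image_eqI)
    moreover have "{u i, v (i + 1)} \<in> (\<lambda>(x, y). {x, y}) ` darts"
      using dartsI(4)[of "i + 1"] by (auto simp: insert_commute intro!: rev_image_eqI)
    moreover have "{u i, v (i + c)} \<in> (\<lambda>(x, y). {x, y}) ` darts"
      using dartsI(5)[of "i + c"] by (auto simp: insert_commute intro!: rev_image_eqI)
    moreover have "{u i, u (i + 1)} \<in> (\<lambda>(x, y). {x, y}) ` darts"
      "{u i, v i} \<in> (\<lambda>(x, y). {x, y}) ` darts" "{u i, v (i + b)} \<in> (\<lambda>(x, y). {x, y}) ` darts"
      by (rule rev_image_eqI, rule dartsI(1), simp, rule rev_image_eqI, rule dartsI(2), simp,
          rule rev_image_eqI, rule dartsI(3), simp)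
    ultimately show "s \<in> (\<lambda>(x, y). {x, y}) ` darts"
      using i unfolding e_def by blast
  next
    fix s assume "s \<in> (\<lambda>(x, y). {x, y}) ` darts"
    then obtain i where i: "s \<in> {{u i, u (i + 1)}, {u i, v i}, {u i, v (i + b)},
     {v i, u (i - 1)}, {v i, u (i - c)}, {v i, v (i + m + 1)}}"
      by (auto simp: darts_def)
    have "v i = v (i + m + 1 + m - 1)" using v_shift[of i 1] by (simp add: algebra_simps)
    then have "{v i, v (i + m + 1)} \<in> e (i + m + 1)" by (simp add: e_def insert_commute)
    moreover have "{v i, u (i - 1)} \<in> e (i - 1)" "{v i, u (i - c)} \<in> e (i - c)"
      by (simp_all add: e_def insert_commute)
    moreover have "{u i, u (i + 1)} \<in> e i" "{u i, v i} \<in> e i" "{u i, v (i + b)} \<in> e i"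
      by (simp_all add: e_def)
    ultimately show "s \<in> (\<Union>i. e i)" using i by blast
  qed
  finally show ?thesis .
qed

lemma uv_cong:
  assumes "2 * m dvd i - j"
  shows "u (i + d) = u (j + d)" "v (i + d) = v (j + d)"
  using assms by (auto simp: u_eq_iff v_eq_iff)

lemma darts_u_iff: "(u i, y) \<in> darts \<longleftrightarrow> y \<in> {u (i + 1), v i, v (i + b)}"
proof
  assume "(u i, y) \<in> darts"
  then obtain j where j: "u i = u j" "y \<in> {u (j + 1), v j, v (j + b)}" by (auto simp: darts_def)
  then have "2 * m dvd i - j" by (simp add: u_eq_iff)
  from uv_cong[OF this, of 1] uv_cong[OF this, of 0] uv_cong[OF this, of b] j(2)
  show "y \<in> {u (i + 1), v i, v (i + b)}" by auto
qed (auto intro: dartsI)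

lemma darts_v_iff: "(v i, y) \<in> darts \<longleftrightarrow> y \<in> {u (i - 1), u (i - c), v (i + m + 1)}"
proof
  assume "(v i, y) \<in> darts"
  then obtain j where j: "v i = v j" "y \<in> {u (j - 1), u (j - c), v (j + m + 1)}"
    by (auto simp: darts_def)
  then have "2 * m dvd i - j" by (simp add: v_eq_iff)
  from uv_cong[OF this, of "-1"] uv_cong[OF this, of "-c"] uv_cong[OF this, of "m + 1"] j(2)
  show "y \<in> {u (i - 1), u (i - c), v (i + m + 1)}" by (auto simp: add.assoc)
qed (auto intro: dartsI)

lemma edge_iff: "{x, y} \<in> E \<longleftrightarrow> (x, y) \<in> darts \<or> (y, x) \<in> darts"
  by (force simp: edges_G doubleton_eq_iff)

lemma edge_u_iff:
  "{u i, y} \<in> E \<longleftrightarrow> y \<in> {u (i + 1), u (i - 1), v i, v (i + 1), v (i + b), v (i + c)}"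
proof
  assume "{u i, y} \<in> E"
  then consider "(u i, y) \<in> darts" | "(y, u i) \<in> darts" unfolding edge_iff by blast
  then show "y \<in> {u (i + 1), u (i - 1), v i, v (i + 1), v (i + b), v (i + c)}"
  proof cases
    case 2
    then obtain j where "u i = u (j + 1) \<and> y = u j \<or> u i = u (j - 1) \<and> y = v j
      \<or> u i = u (j - c) \<and> y = v j" by (auto simp: darts_def)
    then consider "2 * m dvd i - (j + 1)" "y = u j" | "2 * m dvd i - (j - 1)" "y = v j"
      | "2 * m dvd i - (j - c)" "y = v j" by (auto simp: u_eq_iff)
    then show ?thesis
    proof cases
      case 1 then show ?thesis using uv_cong[OF 1(1), of "-1"] by simp
    next
      case 2 then show ?thesis using uv_cong[OF 2(1), of 1] by simp
    next
      case 3 then show ?thesis using uv_cong[OF 3(1), of c] by simp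
    qed
  qed (auto simp: darts_u_iff)
next
  have "(v (i + 1), u i) \<in> darts" "(v (i + c), u i) \<in> darts" "(u (i - 1), u i) \<in> darts"
    using dartsI(4)[of "i + 1"] dartsI(5)[of "i + c"] dartsI(1)[of "i - 1"] by simp_all
  moreover assume "y \<in> {u (i + 1), u (i - 1), v i, v (i + 1), v (i + b), v (i + c)}"
  ultimately show "{u i, y} \<in> E" by (auto simp: edge_iff darts_u_iff)
qed

lemma edge_v_iff:
  "{v i, y} \<in> E \<longleftrightarrow>
    y \<in> {v (i + m + 1), v (i - m - 1), u i, u (i - 1), u (i - b), u (i - c)}"
proof
  assume "{v i, y} \<in> E"
  then consider "(v i, y) \<in> darts" | "(y, v i) \<in> darts" unfolding edge_iff by blast
  then show "y \<in> {v (i + m + 1), v (i - m - 1), u i, u (i - 1), u (i - b), u (i - c)}"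
  proof cases
    case 2
    then obtain j where "v i = v (j + m + 1) \<and> y = v j \<or> v i = v j \<and> y = u j
      \<or> v i = v (j + b) \<and> y = u j" by (auto simp: darts_def)
    then consider "2 * m dvd i - (j + m + 1)" "y = v j" | "2 * m dvd i - j" "y = u j"
      | "2 * m dvd i - (j + b)" "y = u j" by (auto simp: v_eq_iff)
    then show ?thesis
    proof cases
      case 1 then show ?thesis using uv_cong[OF 1(1), of "-m-1"] by (simp add: algebra_simps)
    next
      case 2 then show ?thesis using uv_cong[OF 2(1), of 0] by simp
    next
      case 3 then show ?thesis using uv_cong[OF 3(1), of "-b"] by simp
    qed
  qed (auto simp: darts_v_iff)
next
  have "(v (i - m - 1), v i) \<in> darts" "(u (i - b), v i) \<in> darts"
    using dartsI(6)[of "i - m - 1"] dartsI(3)[of "i - b"] by simp_all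
  moreover assume "y \<in> {v (i + m + 1), v (i - m - 1), u i, u (i - 1), u (i - b), u (i - c)}"
  ultimately show "{v i, y} \<in> E" by (auto simp: edge_iff darts_v_iff dartsI)
qed

subsection \<open>Automorphisms preserving the orientation\<close>

text \<open>It is enough to send darts to darts injectively: vertices and darts form finite sets, so
  the map is a bijection on both, and preservation in one direction gives the equivalence.\<close>

lemma automorphism_of_dart_maps:
  assumes cong: "\<And>i j. 2 * m dvd i - j \<Longrightarrow> fu i = fu j" "\<And>i j. 2 * m dvd i - j \<Longrightarrow> fv i = fv j"
    and verts: "range fu \<union> range fv \<subseteq> uverts G"
    and inj: "\<And>i j. fu i = fu j \<Longrightarrow> 2 * m dvd i - j" "\<And>i j. fv i = fv j \<Longrightarrow> 2 * m dvd i - j"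
      "\<And>i j. fu i \<noteq> fv j"
    and dart: "\<And>i. (fu i, fu (i + 1)) \<in> darts" "\<And>i. (fu i, fv i) \<in> darts"
      "\<And>i. (fu i, fv (i + b)) \<in> darts" "\<And>i. (fv i, fu (i - 1)) \<in> darts"
      "\<And>i. (fv i, fu (i - c)) \<in> darts" "\<And>i. (fv i, fv (i + m + 1)) \<in> darts"
  obtains f where "f \<in> automorphisms G" "\<And>i. f (u i) = fu i" "\<And>i. f (v i) = fv i"
proof -
  define f where "f x = (if x \<in> uverts G then
    (case x of U k \<Rightarrow> fu (int k) | V k \<Rightarrow> fv (int k)) else x)" for x
  have fu: "f (u i) = fu i" for i
  proof -
    have "f (u i) = fu (i mod (2 * m))"
      using m_gt by (auto simp: f_def verts_G) (simp add: u_def)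
    then show ?thesis using cong(1)[of "i mod (2 * m)" i] by (simp add: mod_eq_dvd_iff[symmetric])
  qed
  have fv: "f (v i) = fv i" for i
  proof -
    have "f (v i) = fv (i mod (2 * m))"
      using m_gt by (auto simp: f_def verts_G) (simp add: v_def)
    then show ?thesis using cong(2)[of "i mod (2 * m)" i] by (simp add: mod_eq_dvd_iff[symmetric])
  qed
  have fin: "finite (uverts G)" by (simp add: G_def nest_graph_def)
  have "f ` uverts G \<subseteq> uverts G" using verts by (auto simp: verts_G fu fv)
  moreover have inj_f: "inj_on f (uverts G)"
    using inj inj(3)[symmetric] by (auto simp: inj_on_def verts_G fu fv u_eq_iff v_eq_iff)
  ultimately have "bij_betw f (uverts G) (uverts G)"
    using fin by (simp add: bij_betw_def endo_inj_surj)
  then have perm: "f permutes uverts G"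
    by (rule bij_imp_permutes) (simp add: f_def)
  have sub: "darts \<subseteq> uverts G \<times> uverts G" by (auto simp: darts_def verts_G)
  have "(f x, f y) \<in> darts" if "(x, y) \<in> darts" for x y
    using that dart by (subst (asm) darts_def) (auto simp: fu fv)
  then have "map_prod f f ` darts \<subseteq> darts" by auto
  moreover have inj_ff: "inj_on (map_prod f f) darts"
    using map_prod_inj_on[OF inj_f inj_f] sub by (rule inj_on_subset)
  moreover have "finite darts" using sub fin by (meson finite_SigmaI finite_subset)
  ultimately have img: "map_prod f f ` darts = darts" by (simp add: endo_inj_surj)
  have iff: "(f x, f y) \<in> darts \<longleftrightarrow> (x, y) \<in> darts" if "x \<in> uverts G" "y \<in> uverts G" for x y
  proof
    assume "(f x, f y) \<in> darts"
    then have "(f x, f y) \<in> map_prod f f ` darts" unfolding img .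
    then obtain x' y' where "(x', y') \<in> darts" "f x = f x'" "f y = f y'" by auto
    moreover from this have "x' \<in> uverts G" "y' \<in> uverts G" using sub by auto
    ultimately show "(x, y) \<in> darts" using that inj_f by (simp add: inj_on_eq_iff)
  next
    assume "(x, y) \<in> darts"
    then have "map_prod f f (x, y) \<in> map_prod f f ` darts" by (rule imageI)
    then show "(f x, f y) \<in> darts" unfolding img by simp
  qed
  then have "f \<in> automorphisms G" using perm by (auto simp: automorphisms_def edge_iff)
  then show thesis using that fu fv by blast
qed

text \<open>The three products describe multiplication by \<open>c / 2\<close> modulo
  \<open>2 * m\<close> on even shifts: it sends \<open>b - 1\<close> to \<open>-2\<close>,
  \<open>c\<close> to \<open>b - 1\<close> and \<open>m\<close> to \<open>m\<close>. They hold
  because \<open>b\<^sup>2 + 3\<close> is four times \<open>s\<^sup>2 + s + 1\<close>, so that the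
  odd number \<open>p\<close> divides \<open>s\<^sup>2 + s + 1\<close>; the cofactor
  \<open>q\<close> is odd too, and so is \<open>s\<close>, which makes the sums
  \<open>q + s\<close>, \<open>q + p\<close> and \<open>s + p\<close> even.\<close>

lemma parametrization:
  obtains s p t k l where "b = 2 * s + 1" "m = 2 * p" "c = 2 * (s + 1 + p)"
    "c * s = 2 * m * t - 2" "c * (s + 1 + p) = 2 * m * k + b - 1" "c * p = 2 * m * l + m"
proof -
  define s where "s = (b - 1) div 2"
  define p where "p = m div 2"
  have s: "b = 2 * s + 1" and p: "m = 2 * p" and odd: "odd s" "odd p"
    using m_mod b_mod unfolding s_def p_def by presburger+
  have "b\<^sup>2 + 3 = 2 * (2 * (s\<^sup>2 + s + 1))" by (simp add: s power2_eq_square algebra_simps)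
  then have "p dvd 2 * (s\<^sup>2 + s + 1)"
    using m_dvd by (metis p mult_dvd_mono dvd_mult_cancel_left zero_neq_numeral)
  then have "p dvd s\<^sup>2 + s + 1"
    using odd(2) by (subst (asm) coprime_dvd_mult_right_iff) auto
  then obtain q where q: "s\<^sup>2 + s + 1 = p * q" by auto
  moreover have "odd (s\<^sup>2 + s + 1)" by simp
  ultimately have "odd q" by simp
  obtain t where t: "q + s = 2 * t" using \<open>odd q\<close> odd(1) by (metis odd_even_add evenE)
  obtain k where k: "q + p = 2 * k" using \<open>odd q\<close> odd(2) by (metis odd_even_add evenE)
  obtain l where l: "s + p = 2 * l" using odd by (metis odd_even_add evenE)
  show thesis
  proof (rule that[OF s p])
    show c: "c = 2 * (s + 1 + p)" by (simp add: c_def s p)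
    have "c * s + 2 = 2 * (s\<^sup>2 + s + 1) + 2 * p * s"
      by (simp add: c power2_eq_square algebra_simps)
    also have "\<dots> = 2 * p * (q + s)" unfolding q by (simp add: algebra_simps)
    finally show "c * s = 2 * m * t - 2" by (simp add: t p algebra_simps)
    have "c * (s + 1 + p) = 2 * (s\<^sup>2 + s + 1) + 2 * p * p + 4 * p * (s + 1) + 2 * s"
      by (simp add: c power2_eq_square algebra_simps)
    also have "\<dots> = 2 * p * (q + p) + 4 * p * (s + 1) + 2 * s"
      unfolding q by (simp add: algebra_simps)
    also have "\<dots> = 2 * p * (2 * k) + 4 * p * (s + 1) + 2 * s" unfolding k ..
    finally show "c * (s + 1 + p) = 2 * m * (k + s + 1) + b - 1"
      by (simp add: p s algebra_simps)
    have "c * p = 2 * p * (s + p) + 2 * p" by (simp add: c algebra_simps)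
    also have "\<dots> = 2 * p * (2 * l) + 2 * p" unfolding l ..
    finally show "c * p = 2 * m * l + m" by (simp add: p)
  qed
qed

lemma u_eqI: "x = y + 2 * m * k \<Longrightarrow> u x = u y" and v_eqI: "x = y + 2 * m * k \<Longrightarrow> v x = v y"
  by (auto simp: u_eq_iff v_eq_iff)

lemma automorphism_shift:
  obtains f where "f \<in> automorphisms G" "\<And>i. f (u i) = u (i + d)" "\<And>i. f (v i) = v (i + d)"
proof (rule automorphism_of_dart_maps[of "\<lambda>i. u (i + d)" "\<lambda>i. v (i + d)"])
  fix i
  show "(u (i + d), u (i + 1 + d)) \<in> darts" "(u (i + d), v (i + b + d)) \<in> darts"
    "(v (i + d), u (i - 1 + d)) \<in> darts" "(v (i + d), u (i - c + d)) \<in> darts"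
    "(v (i + d), v (i + m + 1 + d)) \<in> darts"
    by (simp_all add: darts_u_iff darts_v_iff algebra_simps)
qed (auto simp: u_eq_iff v_eq_iff verts_G dartsI intro: that)

text \<open>Since \<open>m\<close> is even, the square of \<open>m + 1\<close> is 1 modulo
  \<open>2 * m\<close>. Multiplication by \<open>m + 1\<close> is therefore an involution exchanging
  the step 1 between the \<open>u\<close> with the step \<open>m + 1\<close> between the
  \<open>v\<close>.\<close>

lemma automorphism_swap:
  obtains f where "f \<in> automorphisms G" "\<And>i. f (u i) = v ((m + 1) * i)"
    "\<And>i. f (v i) = u ((m + 1) * i - c)"
proof -
  obtain s p where sp: "b = 2 * s + 1" "m = 2 * p" "c = 2 * (s + 1 + p)"
    by (rule parametrization) blast
  have inj: "2 * m dvd i - j" if "2 * m dvd (m + 1) * i - (m + 1) * j" for i j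
  proof -
    have "2 * m dvd (m + 1) * ((m + 1) * i - (m + 1) * j)" using that by (rule dvd_mult)
    also have "(m + 1) * ((m + 1) * i - (m + 1) * j) = (i - j) + 2 * m * ((p + 1) * (i - j))"
      by (simp add: sp algebra_simps)
    finally show ?thesis by (simp only: dvd_add_left_iff dvd_triv_left)
  qed
  have cong: "2 * m dvd (m + 1) * i - (m + 1) * j" if "2 * m dvd i - j" for i j
    using dvd_mult[OF that, of "m + 1"] by (simp add: algebra_simps)
  show thesis
  proof (rule automorphism_of_dart_maps[of "\<lambda>i. v ((m + 1) * i)" "\<lambda>i. u ((m + 1) * i - c)"])
    fix i
    let ?x = "(m + 1) * i"
    have "v ((m + 1) * (i + 1)) = v (?x + m + 1)" by (simp add: algebra_simps)
    then show "(v ?x, v ((m + 1) * (i + 1))) \<in> darts" by (simp only: dartsI)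
    show "(v ?x, u (?x - c)) \<in> darts" by (rule dartsI)
    have "u ((m + 1) * (i + b) - c) = u (?x - 1)"
      by (rule u_eqI[where k = s]) (simp add: sp algebra_simps)
    then show "(v ?x, u ((m + 1) * (i + b) - c)) \<in> darts" by (simp only: dartsI)
    have "v ((m + 1) * (i - 1)) = v (?x - c + b)"
      by (rule v_eqI[where k = 0]) (simp add: c_def algebra_simps)
    then show "(u (?x - c), v ((m + 1) * (i - 1))) \<in> darts" by (simp only: dartsI)
    have "v ((m + 1) * (i - c)) = v (?x - c)"
      by (rule v_eqI[where k = "- (s + 1 + p)"]) (simp add: sp algebra_simps)
    then show "(u (?x - c), v ((m + 1) * (i - c))) \<in> darts" by (simp only: dartsI)
    have "u ((m + 1) * (i + m + 1) - c) = u (?x - c + 1)"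
      by (rule u_eqI[where k = "p + 1"]) (simp add: sp algebra_simps)
    then show "(u (?x - c), u ((m + 1) * (i + m + 1) - c)) \<in> darts" by (simp only: dartsI)
  qed (auto simp: u_eq_iff v_eq_iff verts_G intro: that inj cong)
qed

text \<open>Even \<open>u\<close> are multiplied by \<open>- c / 2\<close>, and the out-neighbours
  \<open>u (2 * j + 1)\<close>, \<open>v (2 * j)\<close>, \<open>v (2 * j + b)\<close> of
  \<open>u (2 * j)\<close> go to \<open>v (- c * j)\<close>, \<open>v (- c * j + b)\<close>,
  \<open>u (- c * j + 1)\<close>, a cyclic change of roles. The dart conditions are checked by
  parity of the index, with the congruences of \<open>parametrization\<close>.\<close>

lemma automorphism_rotation:
  obtains f where "f \<in> automorphisms G" "f (u 0) = u 0" "f (u 1) = v 0" "f (v 0) = v b"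
proof -
  obtain s p t k l where sp: "b = 2 * s + 1" "m = 2 * p" "c = 2 * (s + 1 + p)"
    and cs: "c * s = 2 * m * t - 2" and ch: "c * (s + 1 + p) = 2 * m * k + b - 1"
    and cp: "c * p = 2 * m * l + m"
    by (rule parametrization)
  define fu where "fu i = (if even i then u (- c * (i div 2)) else v (- c * (i div 2)))" for i
  define fv where "fv i = (if even i then v (b - c * (i div 2)) else u (- 1 - c * (i div 2)))" for i
  have fu: "fu (2 * j) = u (- c * j)" "fu (2 * j + 1) = v (- c * j)"
    and fv: "fv (2 * j) = v (b - c * j)" "fv (2 * j + 1) = u (- 1 - c * j)" for j
    by (simp_all add: fu_def fv_def)
  have split: "P" if "\<And>j. i = 2 * j \<Longrightarrow> P" "\<And>j. i = 2 * j + 1 \<Longrightarrow> P" for P and i :: int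
    using that by (meson evenE oddE)
  have even_dvd: "even x" if "2 * m dvd x" for x
    using that by (rule dvd_mult_left)
  show thesis
  proof (rule automorphism_of_dart_maps[of fu fv])
    show "range fu \<union> range fv \<subseteq> uverts G" by (auto simp: fu_def fv_def verts_G)
    fix i
    show "(fu i, fu (i + 1)) \<in> darts"
    proof (rule split[of i])
      fix j assume "i = 2 * j" then show ?thesis by (simp only: fu dartsI)
    next
      fix j assume "i = 2 * j + 1"
      then have "i + 1 = 2 * (j + 1)" by simp
      moreover have "- c * (j + 1) = - c * j - c" by (simp add: algebra_simps)
      ultimately show ?thesis using dartsI(5)[of "- c * j"] \<open>i = 2 * j + 1\<close> by (simp only: fu)
    qed
    show "(fu i, fv i) \<in> darts"
    proof (rule split[of i])
      fix j assume "i = 2 * j"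
      moreover have "b - c * j = - c * j + b" by simp
      ultimately show ?thesis using dartsI(3)[of "- c * j"] by (simp only: fu fv)
    next
      fix j assume "i = 2 * j + 1"
      moreover have "- 1 - c * j = - c * j - 1" by simp
      ultimately show ?thesis using dartsI(4)[of "- c * j"] by (simp only: fu fv)
    qed
    show "(fu i, fv (i + b)) \<in> darts"
    proof (rule split[of i])
      fix j assume i: "i = 2 * j"
      have "u (- 1 - c * (j + s)) = u (- c * j + 1)"
        by (rule u_eqI[where k = "- t"]) (use cs in \<open>simp add: algebra_simps\<close>)
      moreover have "i + b = 2 * (j + s) + 1" by (simp add: i sp(1))
      ultimately show ?thesis using dartsI(1)[of "- c * j"] by (simp only: i fu fv)
    next
      fix j assume i: "i = 2 * j + 1"
      have "v (b - c * (j + s + 1)) = v (- c * j + m + 1)"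
        by (rule v_eqI[where k = "- t - 1"]) (use cs in \<open>simp add: c_def algebra_simps\<close>)
      moreover have "i + b = 2 * (j + s + 1)" by (simp add: i sp(1))
      ultimately show ?thesis using dartsI(6)[of "- c * j"] by (simp only: i fu fv)
    qed
    show "(fv i, fu (i - 1)) \<in> darts"
    proof (rule split[of i])
      fix j assume i: "i = 2 * j"
      have "v (- c * (j - 1)) = v (b - c * j + m + 1)"
        by (rule v_eqI[where k = 0]) (simp add: c_def algebra_simps)
      moreover have "i - 1 = 2 * (j - 1) + 1" by (simp add: i)
      ultimately show ?thesis using dartsI(6)[of "b - c * j"] by (simp only: i fu fv)
    next
      fix j assume i: "i = 2 * j + 1"
      have "- 1 - c * j + 1 = - c * j" "i - 1 = 2 * j" by (simp_all add: i)
      then show ?thesis using dartsI(1)[of "- 1 - c * j"] by (simp only: i fu fv)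
    qed
    show "(fv i, fu (i - c)) \<in> darts"
    proof (rule split[of i])
      fix j assume i: "i = 2 * j"
      have "u (- c * (j - (s + 1 + p))) = u (b - c * j - 1)"
        by (rule u_eqI[where k = k]) (use ch in \<open>simp add: algebra_simps\<close>)
      moreover have "i - c = 2 * (j - (s + 1 + p))" by (simp add: i sp(3))
      ultimately show ?thesis using dartsI(4)[of "b - c * j"] by (simp only: i fv fu)
    next
      fix j assume i: "i = 2 * j + 1"
      have "v (- c * (j - (s + 1 + p))) = v (- 1 - c * j + b)"
        by (rule v_eqI[where k = k]) (use ch in \<open>simp add: algebra_simps\<close>)
      moreover have "i - c = 2 * (j - (s + 1 + p)) + 1" by (simp add: i sp(3))
      ultimately show ?thesis using dartsI(3)[of "- 1 - c * j"] by (simp only: i fv fu)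
    qed
    show "(fv i, fv (i + m + 1)) \<in> darts"
    proof (rule split[of i])
      fix j assume i: "i = 2 * j"
      have "u (- 1 - c * (j + p)) = u (b - c * j - c)"
        by (rule u_eqI[where k = "- l"]) (use cp in \<open>simp add: c_def algebra_simps\<close>)
      moreover have "i + m + 1 = 2 * (j + p) + 1" by (simp add: i sp(2))
      ultimately show ?thesis using dartsI(5)[of "b - c * j"] by (simp only: i fv)
    next
      fix j assume i: "i = 2 * j + 1"
      have "v (b - c * (j + p + 1)) = v (- 1 - c * j)"
        by (rule v_eqI[where k = "- l - 1"]) (use cp in \<open>simp add: c_def algebra_simps\<close>)
      moreover have "i + m + 1 = 2 * (j + p + 1)" by (simp add: i sp(2))
      ultimately show ?thesis using dartsI(2)[of "- 1 - c * j"] by (simp only: i fv)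
    qed
  next
    fix i j
    \<comment> \<open>Multiplication by \<open>s\<close> undoes multiplication by \<open>c\<close>
      up to the factor \<open>-2\<close>, because \<open>c * s\<close> is \<open>-2\<close> modulo
      \<open>2 * m\<close>.\<close>
    have step: "2 * m dvd c * (x - y) \<longleftrightarrow> 2 * m dvd 2 * x - 2 * y" for x y
    proof
      assume "2 * m dvd 2 * x - 2 * y"
      then have "2 * m dvd (2 * x - 2 * y) * (s + 1 + p)" by (rule dvd_mult2)
      also have "(2 * x - 2 * y) * (s + 1 + p) = c * (x - y)" unfolding sp(3) by (simp add: algebra_simps)
      finally show "2 * m dvd c * (x - y)" .
    next
      assume "2 * m dvd c * (x - y)"
      then have "2 * m dvd s * (c * (x - y))" by (rule dvd_mult)
      also have "s * (c * (x - y)) = (c * s) * (x - y)" by simp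
      also have "\<dots> = 2 * m * (t * (x - y)) - (2 * x - 2 * y)" unfolding cs by (simp add: algebra_simps)
      finally show "2 * m dvd 2 * x - 2 * y" by (simp only: dvd_diff_right_iff dvd_triv_left)
    qed
    have neg: "d - c * x - (d - c * y) = - (c * (x - y))" for x y d by (simp add: algebra_simps)
    have neg0: "- c * x - - c * y = - (c * (x - y))" for x y by (simp add: algebra_simps)
    have same: "fu (2 * x) = fu (2 * y) \<longleftrightarrow> 2 * m dvd 2 * x - 2 * y"
      "fv (2 * x) = fv (2 * y) \<longleftrightarrow> 2 * m dvd 2 * x - 2 * y"
      "fu (2 * x + 1) = fu (2 * y + 1) \<longleftrightarrow> 2 * m dvd 2 * x - 2 * y"
      "fv (2 * x + 1) = fv (2 * y + 1) \<longleftrightarrow> 2 * m dvd 2 * x - 2 * y" for x y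
      by (simp_all only: fu fv u_eq_iff v_eq_iff neg neg0 dvd_minus_iff step)
    have diff: "2 * x + 1 - (2 * y + 1) = 2 * x - 2 * (y :: int)" for x y by simp
    have fu_iff: "fu i = fu j \<longleftrightarrow> 2 * m dvd i - j"
    proof (rule split[of i]; rule split[of j])
      fix x y assume "j = 2 * y" "i = 2 * x"
      then show ?thesis by (simp only: same)
    next
      fix x y assume "j = 2 * y + 1" "i = 2 * x + 1"
      then show ?thesis by (simp only: same diff)
    next
      fix x y assume "j = 2 * y" "i = 2 * x + 1"
      then show ?thesis using even_dvd[of "i - j"] by (auto simp only: fu u_neq_v) simp_all
    next
      fix x y assume "j = 2 * y + 1" "i = 2 * x"
      then show ?thesis using even_dvd[of "i - j"] by (auto simp only: fu u_neq_v) simp_all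
    qed
    have fv_iff: "fv i = fv j \<longleftrightarrow> 2 * m dvd i - j"
    proof (rule split[of i]; rule split[of j])
      fix x y assume "j = 2 * y" "i = 2 * x"
      then show ?thesis by (simp only: same)
    next
      fix x y assume "j = 2 * y + 1" "i = 2 * x + 1"
      then show ?thesis by (simp only: same diff)
    next
      fix x y assume "j = 2 * y" "i = 2 * x + 1"
      then show ?thesis using even_dvd[of "i - j"] by (auto simp only: fv u_neq_v) simp_all
    next
      fix x y assume "j = 2 * y + 1" "i = 2 * x"
      then show ?thesis using even_dvd[of "i - j"] by (auto simp only: fv u_neq_v) simp_all
    qed
    show "2 * m dvd i - j \<Longrightarrow> fu i = fu j" "2 * m dvd i - j \<Longrightarrow> fv i = fv j"
      "fu i = fu j \<Longrightarrow> 2 * m dvd i - j" "fv i = fv j \<Longrightarrow> 2 * m dvd i - j"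
      by (simp_all only: fu_iff fv_iff)
    \<comment> \<open>All indices produced by \<open>fu\<close> are even and all those produced by
      \<open>fv\<close> are odd, as \<open>c\<close> is even and \<open>b\<close> is odd.\<close>
    show "fu i \<noteq> fv j"
    proof
      assume eq: "fu i = fv j"
      show False
      proof (rule split[of i]; rule split[of j])
        fix x y assume "j = 2 * y + 1" "i = 2 * x"
        with eq have "2 * m dvd - c * x - (- 1 - c * y)" by (simp only: fu fv u_eq_iff)
        from even_dvd[OF this] show False by (simp add: sp(3))
      next
        fix x y assume "j = 2 * y" "i = 2 * x + 1"
        with eq have "2 * m dvd - c * x - (b - c * y)" by (simp only: fu fv v_eq_iff)
        from even_dvd[OF this] show False by (simp add: sp(1,3))
      qed (use eq in \<open>auto simp only: fu fv u_neq_v\<close>)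
    qed
  next
    fix f assume f: "f \<in> automorphisms G" "\<And>i. f (u i) = fu i" "\<And>i. f (v i) = fv i"
    show thesis by (rule that[OF f(1)]) (simp_all add: f fu_def fv_def)
  qed
qed

text \<open>Powers of the rotation reach the three darts leaving \<open>u 0\<close>, translations
  carry these to every \<open>u i\<close>, and the swap carries darts leaving a \<open>u\<close> to
  darts leaving a \<open>v\<close>.\<close>

lemma dart_transitive:
  assumes "(x, y) \<in> darts"
  obtains f where "f \<in> automorphisms G" "f (u 0) = x" "f (u 1) = y"
proof -
  have at_u: "\<exists>f\<in>automorphisms G. f (u 0) = u i \<and> f (u 1) = y" if uy: "(u i, y) \<in> darts" for i y
  proof -
    obtain r where r: "r \<in> automorphisms G" "r (u 0) = u 0" "r (u 1) = v 0" "r (v 0) = v b"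
      by (rule automorphism_rotation)
    obtain f where f: "f \<in> automorphisms G" "\<And>j. f (u j) = u (j + i)" "\<And>j. f (v j) = v (j + i)"
      using automorphism_shift[of i] by blast
    consider "y = u (i + 1)" | "y = v i" | "y = v (i + b)" using uy by (auto simp: darts_u_iff)
    then show ?thesis
    proof cases
      case 1 then show ?thesis using f by (intro bexI[of _ f]) (simp_all add: add.commute)
    next
      case 2 then show ?thesis using f r automorphisms_comp[OF r(1) f(1)]
        by (intro bexI[of _ "f \<circ> r"]) simp_all
    next
      case 3 then show ?thesis
        using f r automorphisms_comp[OF automorphisms_comp[OF r(1) r(1)] f(1)]
        by (intro bexI[of _ "f \<circ> (r \<circ> r)"]) (simp_all add: add.commute)
    qed
  qed
  have at_v: "\<exists>f\<in>automorphisms G. f (u 0) = v i \<and> f (u 1) = y" if "(v i, y) \<in> darts" for i y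
  proof -
    obtain s p where sp: "b = 2 * s + 1" "m = 2 * p" "c = 2 * (s + 1 + p)"
      by (rule parametrization) blast
    obtain f where f: "f \<in> automorphisms G" "\<And>i. f (u i) = v ((m + 1) * i)"
      "\<And>i. f (v i) = u ((m + 1) * i - c)" by (rule automorphism_swap) blast
    \<comment> \<open>Multiplication by \<open>m + 1\<close> is its own inverse, so this is the
      index that the swap takes back to \<open>i\<close>.\<close>
    define j where "j = (m + 1) * i"
    have "f (u j) = v i" unfolding f j_def
      by (rule v_eqI[where k = "(p + 1) * i"]) (simp add: sp(2) algebra_simps)
    moreover have "f (u (j + 1)) = v (i + m + 1)" unfolding f j_def
      by (rule v_eqI[where k = "(p + 1) * i"]) (simp add: sp(2) algebra_simps)
    moreover have "f (v j) = u (i - c)" unfolding f j_def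
      by (rule u_eqI[where k = "(p + 1) * i"]) (simp add: sp(2) algebra_simps)
    moreover have "f (v (j + b)) = u (i - 1)" unfolding f j_def
      by (rule u_eqI[where k = "(p + 1) * i + s"]) (simp add: sp algebra_simps)
    ultimately obtain z where z: "(u j, z) \<in> darts" "f (u j) = v i" "f z = y"
      using \<open>(v i, y) \<in> darts\<close> unfolding darts_u_iff darts_v_iff by blast
    obtain g where g: "g \<in> automorphisms G" "g (u 0) = u j" "g (u 1) = z" using at_u[OF z(1)] by blast
    show ?thesis
      using automorphisms_comp[OF g(1) f(1)] g z by (intro bexI[of _ "f \<circ> g"]) simp_all
  qed
  obtain i where "x = u i \<or> x = v i" using assms by (auto simp: darts_def)
  then have "\<exists>f\<in>automorphisms G. f (u 0) = x \<and> f (u 1) = y"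
    using at_u at_v assms by blast
  with that show thesis by blast
qed

subsection \<open>Triangles and pentagons\<close>

fun val :: "int \<Rightarrow> symbolic_vertex \<Rightarrow> nest_vertex" where
  "val j (t, x, y, z) = (if t then v else u) (j + x + y * b + z * m)"

lemma edge_val_iff: "{val j s, w} \<in> E \<longleftrightarrow> w \<in> val j ` set (nbrs s)"
proof -
  obtain t x y z where s: "s = (t, x, y, z)" by (cases s)
  show ?thesis
    by (cases t) (simp_all add: s edge_u_iff edge_v_iff c_def algebra_simps)
qed

lemma apart_val:
  assumes "apart s t"
  shows "val j s \<noteq> val j t"
proof
  assume eq: "val j s = val j t"
  obtain a x y z a' x' y' z' where st: "s = (a, x, y, z)" "t = (a', x', y', z')"
    by (cases s, cases t)
  define X Y Z where "X = x - x'" and "Y = y - y'" and "Z = z - z'"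
  have "a = a'" using eq by (auto simp: st split: if_splits)
  with eq have "2 * m dvd (j + x + y * b + z * m) - (j + x' + y' * b + z' * m)"
    by (auto simp: st u_eq_iff v_eq_iff split: if_splits)
  also have "\<dots> = X + Y * b + Z * m" by (simp add: X_def Y_def Z_def algebra_simps)
  finally have dvd: "2 * m dvd X + Y * b + Z * m" .
  \<comment> \<open>Modulo 4, \<open>b\<close> is -1 and \<open>m\<close> is 2, while 4 divides
    \<open>2 * m\<close>; hence \<open>X - Y + 2 * Z\<close> vanishes modulo 4.\<close>
  have "m = 4 * (m div 4) + 2" using m_mod by presburger
  moreover have "b = 4 * (b div 4) + 3" using b_mod by presburger
  ultimately obtain m' b' where m': "m = 4 * m' + 2" and b': "b = 4 * b' + 3" by blast
  have "4 dvd 2 * m" using m' by simp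
  then have "4 dvd X + Y * b + Z * m" using dvd dvd_trans by blast
  also have "X + Y * b + Z * m = (X - Y + 2 * Z) + 4 * (Y * b' + Y + Z * m')"
    unfolding m' b' by (simp add: algebra_simps)
  finally have "4 dvd X - Y + 2 * Z" by (simp only: dvd_add_left_iff dvd_triv_left)
  then have mod4: "(X - Y + 2 * Z) mod 4 = 0" by (rule dvd_imp_mod_0)
  have "m dvd (X + Y * b + Z * m) * (X - Y * b)" using dvd by (meson dvd_mult2 dvd_mult_right)
  also have "\<dots> = (X * X + 3 * (Y * Y)) + (m * (Z * (X - Y * b)) - (b\<^sup>2 + 3) * (Y * Y))"
    by (simp add: power2_eq_square algebra_simps)
  finally have "m dvd X * X + 3 * (Y * Y)"
    using m_dvd by (subst (asm) dvd_add_left_iff) auto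
  moreover have "X * X + 3 * (Y * Y) \<in> {4, 12, 16}"
    using assms mod4 \<open>a = a'\<close> by (auto simp: st X_def Y_def Z_def)
  ultimately have d: "m dvd 4 \<or> m dvd 12 \<or> m dvd 16" by auto
  \<comment> \<open>Among the divisors of 4, 12 and 16, only 6 exceeds 2 and is 2 modulo 4. It
    forces \<open>b\<close> to be 7 or 11, but 6 divides neither 52 nor 124.\<close>
  then have "m \<le> 16" by (auto dest: zdvd_imp_le)
  then have "m = 6 \<or> m = 10 \<or> m = 14" using m_mod m_gt by presburger
  then have "m = 6" using d by auto
  moreover from this have "b = 7 \<or> b = 11" using b_mod b_gt b_less by presburger
  ultimately show False using m_dvd by auto
qed

lemma same_val: "same s t \<Longrightarrow> val j s = val j t"
proof -
  assume "same s t"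
  then obtain a x y z z' where st: "s = (a, x, y, z)" "t = (a, x, y, z')" "(z - z') mod 2 = 0"
    by (cases s; cases t) auto
  then obtain k where "z = z' + 2 * k" by (metis add.commute diff_add_cancel evenE even_iff_mod_2_eq_zero)
  then show ?thesis by (auto simp: st u_eq_iff v_eq_iff algebra_simps)
qed

lemma common_nbrs_val:
  assumes "{val j s, w} \<in> E" "{val j t, w} \<in> E"
  shows "w \<in> val j ` set (common_nbrs s t)"
proof -
  obtain p r where "p \<in> set (nbrs s)" "w = val j p" "r \<in> set (nbrs t)" "w = val j r"
    using assms by (auto simp: edge_val_iff)
  moreover from this have "\<not> apart r p" using apart_val by metis
  ultimately show ?thesis by (auto simp: common_nbrs_def)
qed

text \<open>The 5-cycle runs through \<open>w\<close>, \<open>x\<close>, \<open>p\<close>,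
  \<open>q\<close>, \<open>y\<close>. Its two edges at \<open>w\<close> and the distinctness of
  \<open>x\<close> and \<open>y\<close> are required in \<open>twisted\<close>.\<close>

definition pentagon :: "nest_vertex \<Rightarrow> nest_vertex \<Rightarrow> nest_vertex \<Rightarrow> nest_vertex \<Rightarrow> nest_vertex \<Rightarrow> bool"
  where "pentagon w x y p q \<longleftrightarrow> {x, p} \<in> E \<and> {p, q} \<in> E \<and> {y, q} \<in> E \<and>
    p \<noteq> w \<and> q \<noteq> w \<and> p \<noteq> y \<and> q \<noteq> x"

text \<open>Two neighbours of \<open>w\<close> on at least two common pentagons through
  \<open>w\<close>: a property preserved by automorphisms that tells apart pairs of
  neighbours.\<close>

definition twisted :: "nest_vertex \<Rightarrow> nest_vertex \<Rightarrow> nest_vertex \<Rightarrow> bool" where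
  "twisted w x y \<longleftrightarrow> {w, x} \<in> E \<and> {w, y} \<in> E \<and> x \<noteq> y \<and>
    (\<exists>p q p' q'. pentagon w x y p q \<and> pentagon w x y p' q' \<and> (p, q) \<noteq> (p', q'))"

lemma pentagons_val:
  assumes "pentagon (val j w) (val j s) (val j t) p q"
  shows "(p, q) \<in> map_prod (val j) (val j) ` set (pentagons w s t)"
proof -
  obtain p' q' where pq: "p' \<in> set (nbrs s)" "p = val j p'" "q' \<in> set (nbrs t)" "q = val j q'"
    using assms by (auto simp: pentagon_def edge_val_iff)
  moreover obtain r where "r \<in> set (nbrs p')" "q = val j r"
    using assms pq by (auto simp: pentagon_def edge_val_iff)
  moreover from this pq have "\<not> apart r q'" using apart_val by metis
  moreover have "p \<noteq> val j w" "q \<noteq> val j w" "p \<noteq> val j t" "q \<noteq> val j s"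
    using assms by (simp_all only: pentagon_def not_False_eq_True)
  then have "\<not> same p' w" "\<not> same q' w" "\<not> same p' t" "\<not> same q' s"
    unfolding pq by (blast dest: same_val)+
  ultimately have "(p', q') \<in> set (pentagons w s t)" by (auto simp: pentagons_def)
  then show ?thesis using pq by force
qed

text \<open>Evaluating \<open>common_nbrs\<close> on names leaves a single candidate, uniformly in
  \<open>m\<close> and \<open>b\<close>.\<close>

lemma triangle_uu:
  assumes "{u i, w} \<in> E" "{u (i + 1), w} \<in> E"
  shows "w = v (i + 1)"
proof -
  have "common_nbrs (False, 0, 0, 0) (False, 1, 0, 0) = [(True, 1, 0, 0)]" by code_simp
  then show ?thesis using common_nbrs_val[of i "(False, 0, 0, 0)" w "(False, 1, 0, 0)"] assms by simp
qed

lemma triangle_uv: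
  assumes "{u i, w} \<in> E" "{v i, w} \<in> E"
  shows "w = u (i - 1)"
proof -
  have "common_nbrs (False, 0, 0, 0) (True, 0, 0, 0) = [(False, -1, 0, 0)]" by code_simp
  then show ?thesis using common_nbrs_val[of i "(False, 0, 0, 0)" w "(True, 0, 0, 0)"] assms by simp
qed

lemma twisted_v: "twisted (u i) (v i) (v (i + 1))"
proof -
  have neq: "val i s \<noteq> val i t" if "apart s t" for s t using that by (rule apart_val)
  have "u (i - b) \<noteq> u i" "u (i - b + 1) \<noteq> u i" "u (i - c) \<noteq> u i" "u (i - c + 1) \<noteq> u i"
    "u (i - b) \<noteq> u (i - c)" "v i \<noteq> v (i + 1)"
    using neq[of "(False, 0, -1, 0)" "(False, 0, 0, 0)"] neq[of "(False, 1, -1, 0)" "(False, 0, 0, 0)"]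
      neq[of "(False, -1, -1, -1)" "(False, 0, 0, 0)"] neq[of "(False, 0, -1, -1)" "(False, 0, 0, 0)"]
      neq[of "(False, 0, -1, 0)" "(False, -1, -1, -1)"] neq[of "(True, 0, 0, 0)" "(True, 1, 0, 0)"]
    by (simp_all add: c_def algebra_simps)
  \<comment> \<open>The shifts by \<open>- b\<close> and \<open>- c\<close> both take the indices of
    \<open>v i\<close> and \<open>v (i + 1)\<close> to consecutive \<open>u\<close>, which gives two
    pentagons.\<close>
  then have "pentagon (u i) (v i) (v (i + 1)) (u (i - b)) (u (i - b + 1))"
    "pentagon (u i) (v i) (v (i + 1)) (u (i - c)) (u (i - c + 1))" "u (i - b) \<noteq> u (i - c)"
    "v i \<noteq> v (i + 1)"
    by (auto simp: pentagon_def edge_u_iff edge_v_iff algebra_simps)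
  moreover have "{u i, v i} \<in> E" "{u i, v (i + 1)} \<in> E" by (simp_all add: edge_u_iff)
  ultimately show ?thesis unfolding twisted_def by blast
qed

text \<open>Together with \<open>v (i + 1)\<close>, each of the four remaining neighbours of
  \<open>u i\<close> lies on at most one pentagon through \<open>u i\<close>; the bound comes from
  evaluating \<open>pentagons\<close>.\<close>

lemma twisted_v_unique:
  assumes "twisted (u i) (v (i + 1)) y"
  shows "y = v i"
proof (rule ccontr)
  let ?o = "(False, 0, 0, 0) :: symbolic_vertex" and ?s = "(True, 1, 0, 0) :: symbolic_vertex"
  assume yv: "y \<noteq> v i"
  have "{val i ?o, y} \<in> E" "y \<noteq> v (i + 1)" using assms by (auto simp: twisted_def)
  then obtain t where t': "y = val i t" "t \<in> set (nbrs ?o)"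
    unfolding edge_val_iff by (elim imageE)
  moreover have "val i (True, 0, 0, 0) = v i" "val i ?s = v (i + 1)" by simp_all
  ultimately have "t \<noteq> (True, 0, 0, 0)" "t \<noteq> ?s"
    using yv \<open>y \<noteq> v (i + 1)\<close> by metis+
  with t' have t: "y = val i t"
    "t \<in> {(False, 1, 0, 0), (False, -1, 0, 0), (True, 0, 1, 0), (True, 1, 1, 1)}"
    by auto
  have "\<forall>t\<in>set [(False, 1, 0, 0), (False, -1, 0, 0), (True, 0, 1, 0), (True, 1, 1, 1)].
    length (pentagons ?o ?s t) \<le> 1" by code_simp
  with t(2) have "length (pentagons ?o ?s t) \<le> 1" by auto
  then have uniq: "a = a'" if "a \<in> set (pentagons ?o ?s t)" "a' \<in> set (pentagons ?o ?s t)" for a a'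
    using that by (cases "pentagons ?o ?s t") auto
  obtain p q p' q' where pq: "pentagon (val i ?o) (val i ?s) (val i t) p q"
    "pentagon (val i ?o) (val i ?s) (val i t) p' q'" "(p, q) \<noteq> (p', q')"
    using assms unfolding twisted_def t(1) by auto
  obtain a where "(p, q) = map_prod (val i) (val i) a" "a \<in> set (pentagons ?o ?s t)"
    using pentagons_val[OF pq(1)] by (rule imageE)
  moreover obtain a' where "(p', q') = map_prod (val i) (val i) a'" "a' \<in> set (pentagons ?o ?s t)"
    using pentagons_val[OF pq(2)] by (rule imageE)
  ultimately show False using uniq pq(3) by metis
qed

section \<open>Rigidity of automorphisms and half-arc-transitivity\<close>

lemma edge_verts: "{x, y} \<in> E \<Longrightarrow> x \<in> uverts G \<and> y \<in> uverts G"
  by (auto simp: edge_iff darts_def verts_G)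

lemma automorphism_edge:
  assumes "f \<in> automorphisms G" "{x, y} \<in> E"
  shows "{f x, f y} \<in> E"
  using assms edge_verts[OF assms(2)] by (auto simp: automorphisms_def)

lemma automorphism_inj:
  assumes "f \<in> automorphisms G"
  shows "f x = f y \<longleftrightarrow> x = y"
  using assms permutes_inj[of f "uverts G"] by (auto simp: automorphisms_def inj_eq)

lemma automorphism_twisted:
  assumes "f \<in> automorphisms G" "twisted w x y"
  shows "twisted (f w) (f x) (f y)"
proof -
  have "pentagon (f w) (f x) (f y) (f p) (f q)" if "pentagon w x y p q" for p q
    using that assms(1) by (auto simp: pentagon_def automorphism_edge automorphism_inj)
  with assms show ?thesis
    unfolding twisted_def by (metis automorphism_edge automorphism_inj prod.inject)
qed

lemma no_reversal:
  assumes f: "f \<in> automorphisms G" and f0: "f (u 0) = u 0" and f1: "f (u 1) = u (- 1)"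
  shows False
proof -
  \<comment> \<open>The third vertex of the triangle on \<open>u k\<close>, \<open>u (k + 1)\<close>
    must go to the third vertex of the triangle on their images.\<close>
  have fv: "f (v (k + 1)) = v (- k)" if "f (u k) = u (- k)" "f (u (k + 1)) = u (- k - 1)" for k
  proof -
    have "{u k, v (k + 1)} \<in> E" "{u (k + 1), v (k + 1)} \<in> E" by (simp_all add: edge_u_iff)
    then have "{u (- k), f (v (k + 1))} \<in> E" "{u (- k - 1), f (v (k + 1))} \<in> E"
      using that automorphism_edge[OF f] by metis+
    then show ?thesis using triangle_uu[of "- k - 1"] by simp
  qed
  have fu: "f (u (int k)) = u (- int k) \<and> f (u (int k + 1)) = u (- int k - 1)" for k :: nat
  proof (induction k)
    case 0 then show ?case using f0 f1 by simp
  next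
    case (Suc k)
    let ?k = "int k"
    \<comment> \<open>One step of the walk along the \<open>u\<close>: the twisted partner
      \<open>v (k + 2)\<close> of \<open>v (k + 1)\<close> at \<open>u (k + 1)\<close> goes to the
      partner of \<open>v (- k)\<close> at \<open>u (- k - 1)\<close>. The triangle on
      \<open>u (k + 1)\<close> and \<open>v (k + 2)\<close> then determines the image of
      \<open>u (k + 2)\<close>.\<close>
    have "twisted (f (u (?k + 1))) (f (v (?k + 1))) (f (v (?k + 2)))"
      using automorphism_twisted[OF f twisted_v[of "?k + 1"]] by (simp add: add.assoc)
    then have "f (v (?k + 2)) = v (- ?k - 1)"
      using Suc.IH fv[of ?k] twisted_v_unique[of "- ?k - 1"] by simp
    moreover have "{u (?k + 1), u (?k + 2)} \<in> E" "{v (?k + 2), u (?k + 2)} \<in> E"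
      by (simp_all add: edge_u_iff edge_v_iff add.assoc)
    ultimately have "{u (- ?k - 1), f (u (?k + 2))} \<in> E" "{v (- ?k - 1), f (u (?k + 2))} \<in> E"
      using Suc.IH automorphism_edge[OF f] by metis+
    then have "f (u (?k + 2)) = u (- ?k - 2)" using triangle_uv[of "- ?k - 1"] by (simp add: algebra_simps)
    moreover have "int (Suc k) = ?k + 1" "?k + 1 + 1 = ?k + 2"
      "- (?k + 1) = - ?k - 1" "- ?k - 1 - 1 = - ?k - 2" by simp_all
    ultimately show ?case using Suc.IH by (simp only:)
  qed
  have "f (v b) = v (1 - b)"
    using fv[of "b - 1"] fu[of "nat (b - 1)"] b_gt by simp
  moreover have "{u 0, v b} \<in> E" by (simp add: edge_u_iff)
  ultimately have "{u 0, v (1 - b)} \<in> E"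
    using automorphism_edge[OF f, of "u 0" "v b"] f0 by simp
  then have "{val 0 (False, 0, 0, 0), val 0 (True, 1, -1, 0)} \<in> E" by simp
  then obtain r where r: "val 0 (True, 1, -1, 0) = val 0 r" "r \<in> set (nbrs (False, 0, 0, 0))"
    unfolding edge_val_iff by (rule imageE)
  have "\<forall>r\<in>set (nbrs (False, 0, 0, 0)). apart (True, 1, -1, 0) r" by code_simp
  with r(2) have "apart (True, 1, -1, 0) r" by blast
  from apart_val[OF this] r(1) show False by blast
qed

text \<open>Transporting the reversed dart to \<open>u 0\<close>, \<open>u 1\<close> gives an
  automorphism that swaps these two vertices. Followed by the translation by -1, it fixes
  \<open>u 0\<close> and moves \<open>u 1\<close> to \<open>u (- 1)\<close>, contrary to
  \<open>no_reversal\<close>.\<close>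

lemma automorphism_not_reversing:
  assumes f: "f \<in> automorphisms G" and xy: "(x, y) \<in> darts"
  shows "(f y, f x) \<notin> darts"
proof
  assume "(f y, f x) \<in> darts"
  then obtain h where h: "h \<in> automorphisms G" "h (u 0) = f y" "h (u 1) = f x"
    by (rule dart_transitive)
  obtain g where g: "g \<in> automorphisms G" "g (u 0) = x" "g (u 1) = y"
    using xy by (rule dart_transitive)
  obtain r where r: "r \<in> automorphisms G" "\<And>i. r (u i) = u (i + - 1)"
    using automorphism_shift[of "- 1"] by blast
  have "inv h (h z) = z" for z using automorphism_inj[OF h(1)] by (simp add: inv_f_f inj_def)
  then have "inv h (f x) = u 1" "inv h (f y) = u 0" using h by metis+
  then have "(r \<circ> (inv h \<circ> (f \<circ> g))) (u 0) = u 0" "(r \<circ> (inv h \<circ> (f \<circ> g))) (u 1) = u (- 1)"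
    using g r(2)[of 0] r(2)[of 1] by simp_all
  moreover have "r \<circ> (inv h \<circ> (f \<circ> g)) \<in> automorphisms G"
    using f g(1) h(1) r(1) by (intro automorphisms_comp automorphism_inv)
  ultimately show False using no_reversal by blast
qed

lemma automorphism_darts:
  assumes "f \<in> automorphisms G" "(x, y) \<in> darts"
  shows "(f x, f y) \<in> darts"
  using automorphism_edge[of f x y] automorphism_not_reversing[OF assms] assms by (auto simp: edge_iff)

lemma darts_antisym:
  assumes "(x, y) \<in> darts"
  shows "(y, x) \<notin> darts"
  using automorphism_not_reversing[of id, OF _ assms] by (auto simp: automorphisms_def permutes_id)

lemma darts_homogeneous:
  assumes "(x, y) \<in> darts" "(x', y') \<in> darts"
  shows "\<exists>f\<in>automorphisms G. f x = x' \<and> f y = y'"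
proof -
  obtain g where g: "g \<in> automorphisms G" "g (u 0) = x" "g (u 1) = y"
    using assms(1) by (rule dart_transitive)
  obtain h where h: "h \<in> automorphisms G" "h (u 0) = x'" "h (u 1) = y'"
    using assms(2) by (rule dart_transitive)
  have "inv g (g z) = z" for z using automorphism_inj[OF g(1)] by (simp add: inv_f_f inj_def)
  then have "inv g x = u 0" "inv g y = u 1" using g by metis+
  then show ?thesis
    using automorphisms_comp[OF automorphism_inv[OF g(1)] h(1)] h
    by (intro bexI[of _ "h \<circ> inv g"]) simp_all
qed

lemma half_arc_transitive_G: "half_arc_transitive G"
proof -
  \<comment> \<open>Every vertex is the tail of a dart, so transitivity on darts implies
    transitivity on vertices.\<close>
  have "\<exists>y. (x, y) \<in> darts" if "x \<in> uverts G" for x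
    using that dartsI(2,4) by (auto simp: verts_G)
  then have "vertex_transitive G"
    unfolding vertex_transitive_def by (meson darts_homogeneous)
  moreover have "edge_transitive G"
    unfolding edge_transitive_def
  proof (intro ballI)
    fix e e' assume "e \<in> E" "e' \<in> E"
    then obtain x y x' y' where e: "e = {x, y}" "(x, y) \<in> darts" "e' = {x', y'}" "(x', y') \<in> darts"
      by (auto simp: edges_G)
    then show "\<exists>f\<in>automorphisms G. f ` e = e'"
      using darts_homogeneous[OF e(2,4)] by auto
  qed
  moreover have "\<not> arc_transitive G"
  proof
    assume "arc_transitive G"
    then have "\<exists>f\<in>automorphisms G. f x = x' \<and> f y = y'"
      if "(x, y) \<in> arcs G" "(x', y') \<in> arcs G" for x y x' y'
      using that unfolding arc_transitive_def by fast
    moreover have "(u 0, u 1) \<in> arcs G" "(u 0, u (- 1)) \<in> arcs G" by (simp_all add: arcs_def edge_u_iff)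
    ultimately obtain f where "f \<in> automorphisms G" "f (u 0) = u 0" "f (u 1) = u (- 1)"
      by blast
    then show False by (rule no_reversal)
  qed
  ultimately show ?thesis by (simp add: half_arc_transitive_def)
qed

text \<open>The orbit of a dart is the set of all darts, and every edge carries a dart in one of its
  two directions.\<close>

lemma induced_orientation_cases:
  assumes "induced_orientation G D"
  shows "D = darts \<or> D = darts\<inverse>"
proof -
  obtain x y where xy: "{x, y} \<in> E" and D: "D = {(f x, f y) | f. f \<in> automorphisms G}"
    using assms by (auto simp: induced_orientation_def arcs_def)
  have orbit: "{(f x, f y) | f. f \<in> automorphisms G} = darts" if "(x, y) \<in> darts" for x y
  proof (intro equalityI subsetI)
    fix d assume "d \<in> {(f x, f y) | f. f \<in> automorphisms G}"
    then show "d \<in> darts" using automorphism_darts[OF _ that] by auto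
  next
    fix d assume "d \<in> darts"
    then show "d \<in> {(f x, f y) | f. f \<in> automorphisms G}"
      using darts_homogeneous[OF that, of "fst d" "snd d"] by (cases d) auto
  qed
  from xy consider "(x, y) \<in> darts" | "(y, x) \<in> darts" unfolding edge_iff by blast
  then show ?thesis
  proof cases
    case 1 then show ?thesis using orbit[OF 1] D by simp
  next
    case 2
    have "D = {(f y, f x) | f. f \<in> automorphisms G}\<inverse>" unfolding D by auto
    then show ?thesis using orbit[OF 2] by simp
  qed
qed

subsection \<open>Alternets\<close>

text \<open>The colour of the darts leaving a vertex. The offset 1 for \<open>v\<close> makes the
  colour grow by one along every dart.\<close>

fun colour :: "nest_vertex \<Rightarrow> int" where
  "colour (U k) = int k mod gcd 3 m"
| "colour (V k) = (int k + 1) mod gcd 3 m"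

lemma colour_u: "colour (u i) = i mod gcd 3 m" and colour_v: "colour (v i) = (i + 1) mod gcd 3 m"
proof -
  have "gcd 3 m dvd 2 * m" by simp
  then have *: "i mod (2 * m) mod gcd 3 m = i mod gcd 3 m" by (rule mod_mod_cancel)
  then have "(i mod (2 * m) + 1) mod gcd 3 m = (i + 1) mod gcd 3 m" by (rule mod_add_cong) simp
  with * show "colour (u i) = i mod gcd 3 m" "colour (v i) = (i + 1) mod gcd 3 m"
    using m_gt by (simp_all add: u_def v_def)
qed

lemma gcd_3_m: "gcd 3 m = (if 3 dvd m then 3 else 1)"
proof (cases "3 dvd m")
  case False
  have "gcd 3 m dvd 3" "gcd 3 m > 0" by simp_all
  then have "gcd 3 m \<le> 3" by (auto dest: zdvd_imp_le)
  with \<open>gcd 3 m > 0\<close> consider "gcd 3 m = 1" | "gcd 3 m = 2" | "gcd 3 m = 3" by linarith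
  then show ?thesis
  proof cases
    case 2
    then show ?thesis using \<open>gcd 3 m dvd 3\<close> by simp
  next
    case 3
    then show ?thesis using False by (metis gcd_dvd2)
  qed (use False in simp)
qed (auto simp: gcd_proj1_if_dvd)

lemma gcd_dvd_b: "gcd 3 m dvd b"
proof (cases "3 dvd m")
  case True
  then have "3 dvd b\<^sup>2 + 3" using m_dvd by (rule dvd_trans)
  then have "b\<^sup>2 mod 3 = 0" by presburger
  then have "(b mod 3)\<^sup>2 mod 3 = 0" by (simp only: power_mod)
  moreover have "b mod 3 = 0 \<or> b mod 3 = 1 \<or> b mod 3 = 2" by presburger
  ultimately have "b mod 3 = 0" by auto
  then have "3 dvd b" by (rule mod_0_imp_dvd)
  then show ?thesis by (simp add: gcd_3_m)
qed (simp add: gcd_3_m)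

text \<open>The colour of the tail is that of the head minus one, since \<open>gcd 3 m\<close>
  divides 3, \<open>b\<close> and \<open>m\<close>; so the head determines it.\<close>

lemma colour_common_head:
  assumes "(x, y) \<in> darts" "(x', y) \<in> darts"
  shows "colour x = colour x'"
proof -
  let ?g = "gcd 3 m"
  have "colour x = (colour y - 1) mod ?g" if xy: "(x, y) \<in> darts" for x y
  proof -
    from xy obtain i where "x = u i \<and> y = u (i + 1) \<or> x = u i \<and> y = v i \<or> x = u i \<and> y = v (i + b)
      \<or> x = v i \<and> y = u (i - 1) \<or> x = v i \<and> y = u (i - c) \<or> x = v i \<and> y = v (i + m + 1)"
      by (auto simp: darts_def)
    then show ?thesis
      by (elim disjE; simp add: colour_u colour_v mod_diff_left_eq mod_eq_dvd_iff c_def gcd_dvd_b;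
          intro dvd_add; simp add: gcd_dvd_b)
  qed
  from this[OF assms(1)] this[OF assms(2)] show ?thesis by simp
qed

definition coheaded :: "nest_vertex \<Rightarrow> nest_vertex \<Rightarrow> bool" where
  "coheaded x x' \<longleftrightarrow> (\<exists>y. (x, y) \<in> darts \<and> (x', y) \<in> darts)"

text \<open>Compositions of shared heads shift the index of a \<open>u\<close> by \<open>m\<close>
  and by 3, hence by \<open>gcd 3 m\<close> according to Bezout, and each \<open>v\<close> is joined
  to a \<open>u\<close> of its colour.\<close>

lemma coheaded_connected:
  assumes "x \<in> uverts G" "x' \<in> uverts G" "colour x = colour x'"
  shows "coheaded\<^sup>*\<^sup>* x x'"
proof -
  have sym: "coheaded\<^sup>*\<^sup>* y x" if "coheaded\<^sup>*\<^sup>* x y" for x y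
    using that by (induction rule: rtranclp_induct)
      (auto simp: coheaded_def intro: converse_rtranclp_into_rtranclp)
  have hop: "coheaded\<^sup>*\<^sup>* x x'" if "(x, y) \<in> darts" "(x', y) \<in> darts" for x x' y
    using that by (intro r_into_rtranclp) (auto simp: coheaded_def)
  \<comment> \<open>The shared heads in this and the next three facts are \<open>u (i + 1)\<close>,
    \<open>v i\<close>, \<open>v i\<close> and \<open>u (i + 1)\<close>.\<close>
  have uv2: "coheaded\<^sup>*\<^sup>* (u i) (v (i + 2))" for i
    using hop[OF dartsI(1)[of i], of "v (i + 2)"] dartsI(4)[of "i + 2"] by (simp add: add.commute)
  have uvm: "coheaded\<^sup>*\<^sup>* (u i) (v (i + m - 1))" for i
  proof -
    have "v (i + m - 1 + m + 1) = v i" by (rule v_eqI[where k = 1]) simp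
    then show ?thesis using hop[OF dartsI(2)[of i]] dartsI(6)[of "i + m - 1"] by simp
  qed
  have uub: "coheaded\<^sup>*\<^sup>* (u i) (u (i - b))" for i
    using hop[OF dartsI(2)[of i]] dartsI(3)[of "i - b"] by simp
  have uvc: "coheaded\<^sup>*\<^sup>* (u i) (v (i + b + m + 2))" for i
  proof -
    have "i + b + m + 2 - c = i + 1" by (simp add: c_def)
    then have "(v (i + b + m + 2), u (i + 1)) \<in> darts" using dartsI(5)[of "i + b + m + 2"] by (simp only:)
    with dartsI(1) show ?thesis by (rule hop)
  qed
  have stepm: "coheaded\<^sup>*\<^sup>* (u i) (u (i + m))" for i
  proof -
    have "coheaded\<^sup>*\<^sup>* (u i) (u (i + b + m))"
      using rtranclp_trans[OF uvc[of i] sym[OF uv2[of "i + b + m"]]] .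
    moreover have "i + b + m - b = i + m" by simp
    ultimately show ?thesis using rtranclp_trans[OF _ uub[of "i + b + m"]] by metis
  qed
  have step3: "coheaded\<^sup>*\<^sup>* (u i) (u (i + 3))" for i
  proof -
    have "coheaded\<^sup>*\<^sup>* (u i) (u (i + 3 - m))"
    proof -
      have "i + 3 - m + m - 1 = i + 2" by simp
      then have "coheaded\<^sup>*\<^sup>* (v (i + 2)) (u (i + 3 - m))" using sym[OF uvm[of "i + 3 - m"]] by (simp only:)
      with uv2 show ?thesis by (rule rtranclp_trans)
    qed
    moreover have "coheaded\<^sup>*\<^sup>* (u (i + 3 - m)) (u (i + 3 - m + m))" by (rule stepm)
    ultimately show ?thesis by simp
  qed
  have multiple: "coheaded\<^sup>*\<^sup>* (u i) (u (i + d * k))" if "\<And>i. coheaded\<^sup>*\<^sup>* (u i) (u (i + d))" for i d k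
  proof (induction k rule: int_induct[where k = 0])
    case base
    then show ?case by simp
  next
    case (step1 k)
    then show ?case using rtranclp_trans[OF _ that[of "i + d * k"]] by (simp add: algebra_simps)
  next
    case (step2 k)
    then show ?case using rtranclp_trans[OF _ sym[OF that[of "i + d * (k - 1)"]]] by (simp add: algebra_simps)
  qed
  have uu: "coheaded\<^sup>*\<^sup>* (u i) (u j)" if "colour (u i) = colour (u j)" for i j
  proof -
    obtain p q where pq: "p * 3 + q * m = gcd 3 m" using bezout_int by blast
    have "gcd 3 m dvd j - i" using that by (simp add: colour_u mod_eq_dvd_iff dvd_diff_commute)
    then obtain k where k: "j - i = gcd 3 m * k" by auto
    have "coheaded\<^sup>*\<^sup>* (u i) (u (i + 3 * (p * k) + m * (q * k)))"
      using rtranclp_trans[OF multiple[OF step3] multiple[OF stepm]] .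
    also have "i + 3 * (p * k) + m * (q * k) = j"
      using k unfolding pq[symmetric] by (simp add: algebra_simps)
    finally show ?thesis .
  qed
  have to_u: "\<exists>i. coheaded\<^sup>*\<^sup>* x (u i) \<and> colour x = colour (u i)" if x: "x \<in> uverts G" for x
  proof (cases "x \<in> range u")
    case False
    then obtain i where i: "x = v i" using x by (auto simp: verts_G)
    have "coheaded\<^sup>*\<^sup>* (v i) (u (i - 2))" using sym[OF uv2[of "i - 2"]] by simp
    moreover have "colour (v i) = colour (u (i - 2))"
      by (simp add: colour_u colour_v mod_eq_dvd_iff)
    ultimately show ?thesis using i by blast
  next
    case True
    then obtain i where "x = u i" by auto
    then show ?thesis by (intro exI[of _ i]) simp
  qed
  obtain i j where "coheaded\<^sup>*\<^sup>* x (u i)" "colour x = colour (u i)"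
    "coheaded\<^sup>*\<^sup>* x' (u j)" "colour x' = colour (u j)"
    using to_u assms(1,2) by blast
  then show ?thesis
    using uu[of i j] sym assms(3) by (metis rtranclp_trans)
qed

text \<open>The description is unique because only one of the two arcs on an edge is a dart, by
  \<open>darts_antisym\<close>.\<close>

definition edge_colour :: "nest_vertex set \<Rightarrow> int" where
  "edge_colour e = (THE r. \<exists>x y. (x, y) \<in> darts \<and> e = {x, y} \<and> r = colour x)"

lemma edge_colour:
  assumes "(x, y) \<in> darts"
  shows "edge_colour {x, y} = colour x" "edge_colour {y, x} = colour x"
proof -
  show "edge_colour {x, y} = colour x"
    unfolding edge_colour_def using assms darts_antisym
    by (intro the_equality) (auto simp: doubleton_eq_iff)
  then show "edge_colour {y, x} = colour x" by (simp add: insert_commute)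
qed

text \<open>Consecutive edges of an alternating path share their tail, or share their head and then
  have tails of one colour by \<open>colour_common_head\<close>.\<close>

lemma alternates_edge_colour:
  assumes "alternates darts p (x # y # zs)"
  shows "edge_colour {(x # y # zs) ! length zs, (x # y # zs) ! Suc (length zs)} = edge_colour {x, y}"
  using assms
proof (induction zs arbitrary: x y p)
  case (Cons z zs)
  then have alt: "if p then (x, y) \<in> darts \<and> (z, y) \<in> darts else (y, x) \<in> darts \<and> (y, z) \<in> darts"
    by (auto simp: alternates_Cons split: if_splits)
  then have "edge_colour {x, y} = edge_colour {y, z}"
    using colour_common_head by (auto simp: edge_colour split: if_splits)
  moreover have "alternates darts (\<not> p) (y # z # zs)" using Cons.prems by (subst (asm) alternates_Cons) (rule conjunct2)
  ultimately show ?case using Cons.IH[of "\<not> p" y z] by simp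
qed simp

text \<open>Vertices may repeat, so traversing the first edge once more in the opposite direction
  moves the start of the path to its other end. Thus the path can be prolonged at either end of its
  first edge.\<close>

lemma reachability_starts:
  assumes "({x, y}, f) \<in> reachability G darts" "(x, y) \<in> darts"
  obtains zs zs' where "alternates darts True (x # y # zs)" "alternates darts False (y # x # zs')"
    "f = {(x # y # zs) ! length zs, (x # y # zs) ! Suc (length zs)}"
    "f = {(y # x # zs') ! length zs', (y # x # zs') ! Suc (length zs')}"
proof -
  obtain xs p where xs: "alternates darts p xs" "2 \<le> length xs" "{x, y} = {xs ! 0, xs ! 1}"
    "f = {xs ! (length xs - 2), xs ! (length xs - 1)}"
    using assms(1) by (auto simp: reachability_def alternating_path_altdef)
  then obtain a d zs where "xs = a # d # zs" by (cases xs; cases "tl xs") auto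
  with xs have *: "alternates darts p (a # d # zs)" "{x, y} = {a, d}"
    "f = {(a # d # zs) ! length zs, (a # d # zs) ! Suc (length zs)}" by auto
  from *(2) consider "a = x" "d = y" | "a = y" "d = x" by (auto simp: doubleton_eq_iff)
  then show thesis
  proof cases
    case 1
    have "p" using *(1) assms(2) darts_antisym by (auto simp: 1 alternates_Cons split: if_splits)
    then show thesis using that[of zs "y # zs"] * assms(2) by (simp add: 1 alternates_Cons)
  next
    case 2
    have "\<not> p" using *(1) assms(2) darts_antisym by (auto simp: 2 alternates_Cons split: if_splits)
    then show thesis using that[of "x # zs" zs] * assms(2) by (simp add: 2 alternates_Cons)
  qed
qed

lemma reachability_darts:
  "reachability G darts = {(e, f). e \<in> E \<and> f \<in> E \<and> edge_colour e = edge_colour f}"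
proof (intro equalityI subsetI; clarify)
  fix e f assume ef: "(e, f) \<in> reachability G darts"
  then have E: "e \<in> E" "f \<in> E" by (auto simp: reachability_def)
  then obtain x y where xy: "e = {x, y}" "(x, y) \<in> darts" by (auto simp: edges_G)
  obtain zs zs' where "alternates darts True (x # y # zs)" "alternates darts False (y # x # zs')"
    "f = {(x # y # zs) ! length zs, (x # y # zs) ! Suc (length zs)}"
    "f = {(y # x # zs') ! length zs', (y # x # zs') ! Suc (length zs')}"
    using reachability_starts[OF ef[unfolded xy(1)] xy(2)] .
  then have "edge_colour f = edge_colour e" using alternates_edge_colour xy(1) by simp
  with E show "e \<in> E \<and> f \<in> E \<and> edge_colour e = edge_colour f" by simp
next
  fix e f assume e: "e \<in> E" and f: "f \<in> E" and col: "edge_colour e = edge_colour f"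
  \<comment> \<open>The property carried along a chain of shared heads, from the tail of
    \<open>f\<close> to that of \<open>e\<close>: every dart leaving the vertex reaches
    \<open>f\<close>. Fact \<open>head\<close> passes to another dart with the same head, and
    \<open>tail\<close> to all darts with the same tail.\<close>
  let ?S = "\<lambda>x. \<forall>y. (x, y) \<in> darts \<longrightarrow> ({x, y}, f) \<in> reachability G darts"
  obtain x y where xy: "e = {x, y}" "(x, y) \<in> darts" using e by (auto simp: edges_G)
  obtain x' y' where xy': "f = {x', y'}" "(x', y') \<in> darts" using f by (auto simp: edges_G)
  have tail: "?S x" if reach: "({x, y}, f) \<in> reachability G darts" and dart: "(x, y) \<in> darts" for x y
  proof (intro allI impI)
    fix w assume w: "(x, w) \<in> darts"
    obtain zs zs' where "alternates darts True (x # y # zs)" "alternates darts False (y # x # zs')"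
    "f = {(x # y # zs) ! length zs, (x # y # zs) ! Suc (length zs)}"
    "f = {(y # x # zs') ! length zs', (y # x # zs') ! Suc (length zs')}"
    using reachability_starts[OF reach dart] .
    then have "({w, x}, f) \<in> reachability G darts"
      using w f by (intro reachability_Cons) (auto simp: edge_iff)
    then show "({x, w}, f) \<in> reachability G darts" by (simp add: insert_commute)
  qed
  have head: "({w, y}, f) \<in> reachability G darts"
    if reach: "({x, y}, f) \<in> reachability G darts" and dart: "(x, y) \<in> darts"
      and w: "(w, y) \<in> darts" for x y w
  proof -
    obtain zs zs' where "alternates darts True (x # y # zs)" "alternates darts False (y # x # zs')"
    "f = {(x # y # zs) ! length zs, (x # y # zs) ! Suc (length zs)}"
    "f = {(y # x # zs') ! length zs', (y # x # zs') ! Suc (length zs')}"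
    using reachability_starts[OF reach dart] .
    then show ?thesis
      using w f by (intro reachability_Cons) (auto simp: edge_iff)
  qed
  have "alternating_path darts [x', y']"
    using xy'(2) by (auto simp: alternating_path_altdef alternates_def intro!: exI[of _ True])
  then have "({x', y'}, f) \<in> reachability G darts"
    using f xy' by (auto simp: reachability_def intro!: exI[of _ "[x', y']"])
  then have "?S x'" using tail xy'(2) by blast
  have "coheaded\<^sup>*\<^sup>* x' x"
    using edge_verts[of x y] edge_verts[of x' y'] e f col xy xy'
    by (intro coheaded_connected) (auto simp: edge_colour)
  then have "?S x"
  proof (induction rule: rtranclp_induct)
    case base
    show ?case by (rule \<open>?S x'\<close>)
  next
    case (step x w)
    then obtain y where "(x, y) \<in> darts" "(w, y) \<in> darts" by (auto simp: coheaded_def)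
    then show ?case using step.IH head[of x y w] tail[of w y] by blast
  qed
  then show "(e, f) \<in> reachability G darts" using xy by blast
qed

lemma card_alternets:
  assumes "induced_orientation G D"
  shows "card (alternets G D) = (if 3 dvd m then 3 else 1)"
proof -
  have "reachability G D = reachability G darts"
    using induced_orientation_cases[OF assms] reachability_converse by auto
  then have "card (alternets G D) = card (edge_colour ` E)"
    unfolding alternets_def by (simp only: card_quotient_kernel[OF reachability_darts])
  also have "edge_colour ` E = colour ` (fst ` darts)"
    unfolding edges_G image_image by (intro image_cong refl) (auto simp: edge_colour)
  also have "\<dots> = {0..<gcd 3 m}"
  proof (intro equalityI subsetI)
    fix r assume "r \<in> colour ` fst ` darts"
    then show "r \<in> {0..<gcd 3 m}" by (auto simp: darts_def colour_u colour_v)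
  next
    fix r assume r: "r \<in> {0..<gcd 3 m}"
    have "colour (fst (u r, v r)) \<in> colour ` fst ` darts" by (intro imageI dartsI)
    with r show "r \<in> colour ` fst ` darts" by (simp add: colour_u)
  qed
  finally show ?thesis by (simp add: gcd_3_m)
qed

end

section \<open>Return to natural-number parameters\<close>

theorem theorem4p15:
  fixes m b b0 :: nat and \<Gamma> :: "nest_vertex ugraph"
  assumes "\<Gamma> = nest_graph (2 * m) 1 b ((b + m + 1) mod (2 * m)) (m - 1)"
    and "b0 > 1" and "b = 4 * b0 - 1"
    and "m > 2" and "even m" and "m dvd b\<^sup>2 + 3" and "m mod 4 = 2" and "b < 2 * m"
  shows "half_arc_transitive \<Gamma> \<and>
    (\<forall>D. induced_orientation \<Gamma> D \<longrightarrow>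
       (universal_reachability \<Gamma> D \<longleftrightarrow> \<not> 3 dvd m) \<and>
       (3 dvd m \<longrightarrow> card (alternets \<Gamma> D) = 3))"
proof -
  have "int m dvd (int b)\<^sup>2 + 3"
    using assms(6) by (metis of_nat_add of_nat_dvd_iff of_nat_numeral of_nat_power)
  moreover have "int m mod 4 = 2" "int b mod 4 = 3" "int b > 3" using assms(2,3,7) by presburger+
  ultimately interpret nest_family "int m" "int b" "int b + int m + 1"
    using assms(4,8) by unfold_locales auto
  have "\<Gamma> = G" by (simp add: G_def assms(1))
  moreover have "3 dvd int m \<longleftrightarrow> 3 dvd m" by presburger
  ultimately show ?thesis
    using half_arc_transitive_G card_alternets by (simp add: universal_reachability_def)
qed

end
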